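(* Let $n\ge2$, $s_1,s_2\in(0,1)$, $\sigma<0$, $\Omega:=B_1\subset\mathbb{R}^n$, $g:=0$, $K_1(\xi):=\frac{k_1}{|\xi|^{n+s_1}}$ and $K_2(\xi):=\frac{k_2}{|\xi|^{n+s_2}}$ for some $k_1,k_2>0$. Let $E$ be a volume-constrained minimizer of $\mathcal{C}$. Assume that there exist $p\in\partial B_1$ and $\varepsilon_0>0$ such that $B_{\varepsilon_0}(p)\cap B_1\subseteq(\Omega\setminus E)$. Assume also that $\mathrm{Reg}_E\cap\Omega\neq\varnothing$. Then either $s_1>s_2$, or $s_1=s_2$ and $-k_1<\sigma k_2$.
   Context: $E^c:=\mathbb{R}^n\setminus E$; $I_i(E,F):=\int_E\int_FK_i(x-y)\,dx\,dy$ for disjoint measurable $E,F$. For $E\subseteq\Omega$, $\mathcal{C}(E):=I_1(E,E^c\cap\Omega)+\sigma I_2(E,\Omega^c)+\int_Eg(x)\,dx$ (here $g=0$). A volume-constrained minimizer is a set $E\subseteq\Omega$ minimizing $\mathcal{C}$ among all measurable subsets of $\Omega$ with the same Lebesgue measure as $E$, that measure being in $(0,|\Omega|)$. $\mathrm{Reg}_E$ is the set of all $x_0\in\overline{\Omega\cap\partial E}$ for which there exist $\rho>0$ and $\alpha\in(s_1,1)$ such that $B_\rho(x_0)\cap\overline{\Omega\cap\partial E}$ is a manifold of class $C^{1,\alpha}$, possibly with boundary, and the boundary (if any) is contained in $\partial\Omega$. *)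

theory Defs
  imports "HOL-Analysis.Analysis"
begin

definition interaction ::
    "('a::euclidean_space \<Rightarrow> real) \<Rightarrow> 'a set \<Rightarrow> 'a set \<Rightarrow> ennreal" where
  "interaction K E F =
     (\<integral>\<^sup>+x\<in>E. (\<integral>\<^sup>+y\<in>F. ennreal (K (x - y)) \<partial>lebesgue) \<partial>lebesgue)"

text \<open>The energy takes extended real values because the first interaction may be infinite.\<close>

definition capillarity_energy ::
    "('a::euclidean_space \<Rightarrow> real) \<Rightarrow> ('a \<Rightarrow> real) \<Rightarrow> real \<Rightarrow> ('a \<Rightarrow> real) \<Rightarrow> 'a set \<Rightarrow> 'a set \<Rightarrow> ereal"
  where
  "capillarity_energy K1 K2 \<sigma> g \<Omega> E =
     enn2ereal (interaction K1 E (- E \<inter> \<Omega>))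
     + ereal \<sigma> * enn2ereal (interaction K2 E (- \<Omega>))
     + ereal (LINT x:E|lebesgue. g x)"

definition volume_constrained_minimizer ::
    "('a::euclidean_space \<Rightarrow> real) \<Rightarrow> ('a \<Rightarrow> real) \<Rightarrow> real \<Rightarrow> ('a \<Rightarrow> real) \<Rightarrow> 'a set \<Rightarrow> 'a set \<Rightarrow> bool"
  where
  "volume_constrained_minimizer K1 K2 \<sigma> g \<Omega> E \<longleftrightarrow>
     E \<in> sets lebesgue \<and> E \<subseteq> \<Omega> \<and>
     0 < emeasure lebesgue E \<and> emeasure lebesgue E < emeasure lebesgue \<Omega> \<and>
     (\<forall>F. F \<in> sets lebesgue \<and> F \<subseteq> \<Omega> \<and> emeasure lebesgue F = emeasure lebesgue E \<longrightarrow>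
        capillarity_energy K1 K2 \<sigma> g \<Omega> E \<le> capillarity_energy K1 K2 \<sigma> g \<Omega> F)"

text \<open>The Hoelder bound is uniform on \<open>U\<close>. Below, \<open>U\<close> is a chart domain that may be shrunk around
  a given point, so this gives the same manifolds as a local Hoelder condition.\<close>

definition C1_holder_on ::
    "real \<Rightarrow> 'a::real_normed_vector set \<Rightarrow> ('a \<Rightarrow> 'b::real_normed_vector) \<Rightarrow> bool" where
  "C1_holder_on \<alpha> U f \<longleftrightarrow>
     (\<exists>f'. (\<forall>x\<in>U. (f has_derivative blinfun_apply (f' x)) (at x)) \<and>
           (\<exists>C. \<forall>x\<in>U. \<forall>y\<in>U. norm (f' x - f' y) \<le> C * dist x y powr \<alpha>))"

definition C1_holder_diffeo ::
    "real \<Rightarrow> 'a::euclidean_space set \<Rightarrow> 'a set \<Rightarrow> ('a \<Rightarrow> 'a) \<Rightarrow> ('a \<Rightarrow> 'a) \<Rightarrow> bool" where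
  "C1_holder_diffeo \<alpha> U V \<Phi> \<Psi> \<longleftrightarrow>
     open U \<and> open V \<and> homeomorphism U V \<Phi> \<Psi> \<and> C1_holder_on \<alpha> U \<Phi> \<and> C1_holder_on \<alpha> V \<Psi>"

text \<open>Embedded \<open>k\<close>-dimensional submanifolds with (possibly empty) boundary: near each of its points
  \<open>M\<close> is straightened by an ambient diffeomorphism to a \<open>k\<close>-dimensional subspace \<open>L\<close>, or to a closed
  half-space of \<open>L\<close> with the point lying on its edge.\<close>

definition submanifold_interior ::
    "real \<Rightarrow> nat \<Rightarrow> 'a::euclidean_space set \<Rightarrow> 'a set" where
  "submanifold_interior \<alpha> k M =
     {x\<in>M. \<exists>U V \<Phi> \<Psi> L. C1_holder_diffeo \<alpha> U V \<Phi> \<Psi> \<and> x \<in> U \<and>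
        subspace L \<and> dim L = k \<and> \<Phi> ` (U \<inter> M) = V \<inter> L}"

definition submanifold_boundary ::
    "real \<Rightarrow> nat \<Rightarrow> 'a::euclidean_space set \<Rightarrow> 'a set" where
  "submanifold_boundary \<alpha> k M =
     {x\<in>M. \<exists>U V \<Phi> \<Psi> L \<nu>. C1_holder_diffeo \<alpha> U V \<Phi> \<Psi> \<and> x \<in> U \<and>
        subspace L \<and> dim L = k \<and> \<nu> \<in> L \<and> \<nu> \<noteq> 0 \<and>
        \<Phi> ` (U \<inter> M) = V \<inter> {y\<in>L. 0 \<le> \<nu> \<bullet> y} \<and> \<nu> \<bullet> \<Phi> x = 0}"

definition C1_holder_submanifold ::
    "real \<Rightarrow> nat \<Rightarrow> 'a::euclidean_space set \<Rightarrow> bool" where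
  "C1_holder_submanifold \<alpha> k M \<longleftrightarrow>
     M \<subseteq> submanifold_interior \<alpha> k M \<union> submanifold_boundary \<alpha> k M"

text \<open>Regularity means being a hypersurface, so the dimension is one less than that of the space;
  \<open>frontier E\<close> is the topological boundary of the given representative \<open>E\<close>.\<close>

definition Reg :: "real \<Rightarrow> 'a::euclidean_space set \<Rightarrow> 'a set \<Rightarrow> 'a set" where
  "Reg s1 \<Omega> E =
     {x0 \<in> closure (\<Omega> \<inter> frontier E). \<exists>\<rho>>0. \<exists>\<alpha>\<in>{s1<..<1}.
        C1_holder_submanifold \<alpha> (DIM('a) - 1) (ball x0 \<rho> \<inter> closure (\<Omega> \<inter> frontier E)) \<and>
        submanifold_boundary \<alpha> (DIM('a) - 1) (ball x0 \<rho> \<inter> closure (\<Omega> \<inter> frontier E))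
          \<subseteq> frontier \<Omega>}"

end

theory Submission
  imports Defs
begin

text \<open>
Suppose that the minimizer \<open>E\<close> leaves a neighbourhood of the boundary point \<open>p\<close> vacant although
\<open>s1 < s2\<close>, or \<open>s1 = s2\<close> and \<open>k1 \<le> - \<sigma> * k2\<close>. In both cases a better competitor of the same volume
exists. The energy of a minimizer is finite, because a ball has finite fractional perimeter
(\<open>interaction_unit_ball_finite\<close>, \<open>minimizer_interaction_finite\<close>).

If \<open>s1 < s2\<close>, the adhesion to the complement of the container dominates at small scales. A ball of
radius \<open>r\<close> internally tangent to the sphere at \<open>p\<close> has adhesion of order \<open>r powr (n - s2)\<close> but
fractional perimeter only of order \<open>r powr (n - s1)\<close>. The volume is compensated by removing the part
of \<open>E\<close> inside a ball of comparable radius in the interior, which an averaging argument provides, at a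
cost of order \<open>r powr (n - s1)\<close> as well. Hence \<open>s2 \<le> s1\<close> (\<open>order_le_if_minimizer_vacant\<close>).

If \<open>s1 = s2\<close> and \<open>k1 \<le> - \<sigma> * k2\<close>, set \<open>F = ball 0 1 - E\<close>. Up to a constant the energy is \<open>k1\<close> times the
fractional perimeter of \<open>F\<close> plus a nonnegative multiple of the interaction of \<open>F\<close> with the complement of
the unit ball. Both terms are lowered by polarization (two-point rearrangement) of \<open>F\<close> with respect to
a half-space that contains the origin, and polarization preserves inclusion in the unit ball. The
first term decreases strictly unless \<open>F\<close> or its mirror image is already polarized
(\<open>polarization_energy_decrease\<close>, \<open>minimizer_polarization_dichotomy\<close>). As \<open>F\<close> fills a neighbourhood of
\<open>p\<close> in the ball, reflections in hyperplanes close to the centre carry this neighbourhood along the sphere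
(\<open>vacant_ball_moves_along_sphere\<close>). So \<open>F\<close> contains a whole shell, and one further polarization shows
that \<open>E\<close> is null (\<open>negligible_if_vacant_ball\<close>), which contradicts its positive volume.

Polarization rests on the invariance of Lebesgue measure under reflections, which follows from Vitali's covering theorem by balls (\<open>emeasure_isometry_image_open\<close>).
\<close>

section \<open>Isometries and Lebesgue measure\<close>

text \<open>By the Vitali covering theorem an open set is, up to a null set, a countable disjoint union of
balls. An isometry maps balls to balls of the same radius and, being Lipschitz, null sets to null
sets.\<close>

lemma emeasure_isometry_image_open:
  fixes f :: "'a::euclidean_space \<Rightarrow> 'a"
  assumes dist: "\<And>x y. dist (f x) (f y) = dist x y" and surj: "surj f" and U: "open U"
  shows "emeasure lebesgue (f ` U) = emeasure lebesgue U"
proof -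
  define K where "K = {(c, r). 0 < r \<and> ball c r \<subseteq> U}"
  obtain C where C: "countable C" "C \<subseteq> K"
    and pw: "pairwise (\<lambda>i j. disjnt (ball (fst i) (snd i)) (ball (fst j) (snd j))) C"
    and neg: "negligible (U - (\<Union>i\<in>C. ball (fst i) (snd i)))"
  proof (rule Vitali_covering_theorem_balls[of U K fst snd])
    fix x d assume "x \<in> U" "0 < (d::real)"
    then obtain e where e: "e > 0" "ball x e \<subseteq> U"
      using U by (meson open_contains_ball)
    let ?r = "min e d / 2"
    have "(x, ?r) \<in> K" using e \<open>0 < d\<close> by (auto simp: K_def)
    then show "\<exists>i. i \<in> K \<and> x \<in> ball (fst i) (snd i) \<and> snd i < d"
      using e \<open>0 < d\<close> by (intro exI[of _ "(x, ?r)"]) auto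
  qed blast
  have inj: "inj f" by (rule injI) (metis dist dist_eq_0_iff)
  have ball: "f ` ball c r = ball (f c) r" for c r
  proof -
    have "\<exists>z. y = f z" for y using surj by (meson surjD)
    then show ?thesis by (force simp: dist image_iff)
  qed
  let ?B = "\<lambda>i. ball (fst i) (snd i) :: 'a set"
  have disj: "disjoint_family_on ?B C"
    using pw by (auto simp: disjoint_family_on_def pairwise_def disjnt_def)
  then have disj': "disjoint_family_on (\<lambda>i. f ` ?B i) C"
    unfolding disjoint_family_on_def using inj by (metis image_Int image_empty)
  have vol: "emeasure lebesgue (f ` ?B i) = emeasure lebesgue (?B i)" if "i \<in> C" for i
    using that C(2) by (auto simp: ball K_def emeasure_ball)
  have "f ` (U - (\<Union>i\<in>C. ?B i)) = f ` U - f ` (\<Union>i\<in>C. ?B i)"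
    using inj by (simp add: image_set_diff)
  moreover have "negligible (f ` (U - (\<Union>i\<in>C. ?B i)))"
    by (rule negligible_locally_Lipschitz_image[OF order_refl neg])
       (auto intro!: exI[of _ UNIV] exI[of _ 1] simp: dist dist_norm[symmetric])
  ultimately have neg': "negligible (f ` U - (\<Union>i\<in>C. f ` ?B i))"
    by (simp add: image_UN)
  have eq: "emeasure lebesgue V = emeasure lebesgue W"
    if "negligible (V - W)" "W \<subseteq> V" "W \<in> sets lebesgue" for V W :: "'a set"
  proof -
    have "V = W \<union> (V - W)" using that by auto
    then show ?thesis
      using that emeasure_Un_null_set[of W lebesgue "V - W"] by (auto simp: negligible_iff_null_sets)
  qed
  have sub: "(\<Union>i\<in>C. ?B i) \<subseteq> U" using C(2) by (force simp: K_def)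
  have sets: "(\<Union>i\<in>C. ?B i) \<in> sets lebesgue" "(\<Union>i\<in>C. f ` ?B i) \<in> sets lebesgue"
    using C(1) by (auto intro!: sets.countable_UN'' simp: ball)
  have "emeasure lebesgue U = emeasure lebesgue (\<Union>i\<in>C. ?B i)"
    by (rule eq[OF neg sub]) (use sets in auto)
  also have "\<dots> = (\<integral>\<^sup>+i. emeasure lebesgue (?B i) \<partial>count_space C)"
    by (rule emeasure_UN_countable) (use C(1) disj in auto)
  also have "\<dots> = (\<integral>\<^sup>+i. emeasure lebesgue (f ` ?B i) \<partial>count_space C)"
    by (rule nn_integral_cong) (use vol in auto)
  also have "\<dots> = emeasure lebesgue (\<Union>i\<in>C. f ` ?B i)"
    by (rule emeasure_UN_countable[symmetric]) (use C(1) disj' in \<open>auto simp: ball\<close>)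
  also have "\<dots> = emeasure lebesgue (f ` U)"
    by (rule eq[OF neg', symmetric]) (use sets sub in auto)
  finally show ?thesis by simp
qed

lemma lborel_distr_isometric_involution:
  fixes f :: "'a::euclidean_space \<Rightarrow> 'a"
  assumes dist: "\<And>x y. dist (f x) (f y) = dist x y" and inv: "\<And>x. f (f x) = x"
  shows "distr lborel borel f = lborel"
proof -
  have surj: "surj f" using inv by (metis surjI)
  have cont: "continuous_on UNIV f"
    unfolding continuous_on_iff using dist by auto
  have m[measurable]: "f \<in> borel_measurable borel" 
    by (rule borel_measurable_continuous_onI[OF cont])
  have vim: "f -` S = f ` S" for S using inv by (auto simp: image_iff) metis
  have "lborel = distr lborel borel f"
  proof (rule lborel_eqI)
    fix l u :: 'a assume lu: "\<And>b. b \<in> Basis \<Longrightarrow> l \<bullet> b \<le> u \<bullet> b"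
    have op: "open (f ` box l u)"
      unfolding vim[symmetric] using cont by (auto intro: open_vimage)
    have "emeasure (distr lborel borel f) (box l u) = emeasure lborel (f ` box l u)"
      by (subst emeasure_distr) (auto simp: vim)
    also have "\<dots> = emeasure lebesgue (f ` box l u)" using op by simp
    also have "\<dots> = emeasure lebesgue (box l u)"
      by (rule emeasure_isometry_image_open[OF dist surj]) auto
    also have "\<dots> = ennreal (\<Prod>b\<in>Basis. (u - l) \<bullet> b)"
      using lu by (simp add: emeasure_lborel_box)
    finally show "emeasure (distr lborel borel f) (box l u) = ennreal (\<Prod>b\<in>Basis. (u - l) \<bullet> b)" .
  qed auto
  then show ?thesis by simp
qed

lemma
  fixes f :: "'a::euclidean_space \<Rightarrow> 'a"
  assumes dist: "\<And>x y. dist (f x) (f y) = dist x y" and inv: "\<And>x. f (f x) = x"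
  shows measurable_isometric_involution: "f \<in> lebesgue \<rightarrow>\<^sub>M lebesgue"
    and lebesgue_distr_isometric_involution: "distr lebesgue lebesgue f = lebesgue"
proof -
  have cont: "continuous_on UNIV f"
    unfolding continuous_on_iff using dist by auto
  have m[measurable]: "f \<in> borel \<rightarrow>\<^sub>M borel" 
    by (rule borel_measurable_continuous_onI[OF cont])
  have d: "distr lebesgue lborel f = lborel"
    using lborel_distr_isometric_involution[OF assms]
    by (simp add: distr_completion cong: distr_cong)
  show "f \<in> lebesgue \<rightarrow>\<^sub>M lebesgue"
    by (simp add: completion.measurable_completion2 d measurable_completion)
  show "distr lebesgue lebesgue f = lebesgue"
    by (subst completion.completion_distr_eq[symmetric]) (auto simp: d measurable_completion)
qed

lemma nn_integral_isometric_involution: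
  fixes f :: "'a::euclidean_space \<Rightarrow> 'a"
  assumes "\<And>x y. dist (f x) (f y) = dist x y" and "\<And>x. f (f x) = x"
    and "g \<in> borel_measurable lebesgue"
  shows "(\<integral>\<^sup>+x. g (f x) \<partial>lebesgue) = (\<integral>\<^sup>+x. g x \<partial>lebesgue)"
  using nn_integral_distr[OF measurable_isometric_involution[OF assms(1,2)], of g] assms
  by (simp add: lebesgue_distr_isometric_involution)

lemma nn_integral_lebesgue_affine:
  fixes f :: "'a::euclidean_space \<Rightarrow> ennreal"
  assumes f: "f \<in> borel_measurable lebesgue" and c: "c \<noteq> 0"
  shows "(\<integral>\<^sup>+x. f x \<partial>lebesgue) = ennreal (\<bar>c\<bar> ^ DIM('a)) * (\<integral>\<^sup>+x. f (t + c *\<^sub>R x) \<partial>lebesgue)"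
proof -
  have T: "(\<lambda>x. t + (\<Sum>j\<in>Basis. (c * (x \<bullet> j)) *\<^sub>R j)) = (\<lambda>x::'a. t + c *\<^sub>R x)"
    unfolding scaleR_scaleR[symmetric] scaleR_sum_right[symmetric] euclidean_representation ..
  note m = lebesgue_affine_measurable[of "\<lambda>_. c" t, OF c, unfolded T]
  have "(\<integral>\<^sup>+x. f x \<partial>lebesgue) =
    (\<integral>\<^sup>+x. f x \<partial>density (distr lebesgue lebesgue (\<lambda>x. t + c *\<^sub>R x)) (\<lambda>_. ennreal (\<bar>c\<bar> ^ DIM('a))))"
    using lebesgue_affine_euclidean[of "\<lambda>_. c" t, OF c, unfolded T] by simp
  also have "\<dots> = ennreal (\<bar>c\<bar> ^ DIM('a)) * (\<integral>\<^sup>+x. f x \<partial>distr lebesgue lebesgue (\<lambda>x. t + c *\<^sub>R x))"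
    using f by (simp add: nn_integral_density nn_integral_cmult)
  also have "\<dots> = ennreal (\<bar>c\<bar> ^ DIM('a)) * (\<integral>\<^sup>+x. f (t + c *\<^sub>R x) \<partial>lebesgue)"
    using f m by (simp add: nn_integral_distr)
  finally show ?thesis .
qed

section \<open>The interaction energy of a radial kernel\<close>

lemma sigma_finite_lebesgue: "sigma_finite_measure (lebesgue :: 'a::euclidean_space measure)"
proof
  let ?A = "range (\<lambda>n. ball (0::'a) (real n))"
  have "\<Union>?A = UNIV"
  proof (intro equalityI subsetI UNIV_I)
    fix x :: 'a
    obtain n where "norm x < real n" using reals_Archimedean2 by blast
    then show "x \<in> \<Union>?A" by auto
  qed
  then show "\<exists>A. countable A \<and> A \<subseteq> sets lebesgue \<and> \<Union>A = space (lebesgue::'a measure) \<and>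
        (\<forall>a\<in>A. emeasure lebesgue a \<noteq> \<infinity>)"
    using emeasure_lborel_ball_finite[of "0::'a"]
    by (intro exI[of _ ?A]) (auto simp: less_top)
qed

definition potential :: "('a::euclidean_space \<Rightarrow> real) \<Rightarrow> 'a set \<Rightarrow> 'a \<Rightarrow> ennreal" where
  "potential K F x = (\<integral>\<^sup>+y\<in>F. ennreal (K (x - y)) \<partial>lebesgue)"

lemma interaction_eq_potential:
  "interaction K E F = (\<integral>\<^sup>+x\<in>E. potential K F x \<partial>lebesgue)"
  unfolding interaction_def potential_def ..

text \<open>Radial symmetry is what makes the interaction symmetric in its two sets and invariant under
isometries.\<close>

locale radial_kernel =
  fixes K :: "'a::euclidean_space \<Rightarrow> real"
  assumes borel_K [measurable]: "K \<in> borel_measurable borel"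
    and radial: "\<And>x y. norm x = norm y \<Longrightarrow> K x = K y"
begin

lemma measurable_kernel_diff [measurable]:
  "(\<lambda>(x, y). ennreal (K (x - y))) \<in> borel_measurable (lebesgue \<Otimes>\<^sub>M lebesgue)"
proof -
  have [measurable]: "(\<lambda>p. fst p - snd p) \<in> lebesgue \<Otimes>\<^sub>M lebesgue \<rightarrow>\<^sub>M (borel :: 'a measure)"
  proof (rule borel_measurable_diff)
    show "fst \<in> borel_measurable (lebesgue \<Otimes>\<^sub>M (lebesgue :: 'a measure))"
      by (rule measurable_compose[OF measurable_fst]) (auto intro: measurable_completion)
    show "snd \<in> borel_measurable ((lebesgue :: 'a measure) \<Otimes>\<^sub>M lebesgue)"
      by (rule measurable_compose[OF measurable_snd]) (auto intro: measurable_completion)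
  qed
  show ?thesis by (simp add: case_prod_beta')
qed

lemma measurable_kernel [measurable]: "(\<lambda>y. ennreal (K (x - y))) \<in> borel_measurable lebesgue"
  by (rule measurable_completion) simp

lemma measurable_potential [measurable]:
  assumes [measurable]: "F \<in> sets lebesgue"
  shows "potential K F \<in> borel_measurable lebesgue"
  unfolding potential_def
  by (rule sigma_finite_measure.borel_measurable_nn_integral[OF sigma_finite_lebesgue]) simp

lemma potential_mono: "F \<subseteq> F' \<Longrightarrow> potential K F x \<le> potential K F' x"
  unfolding potential_def by (intro nn_integral_mono) (auto split: split_indicator)

lemma interaction_mono:
  "E \<subseteq> E' \<Longrightarrow> F \<subseteq> F' \<Longrightarrow> interaction K E F \<le> interaction K E' F'"
  unfolding interaction_eq_potential
  by (intro nn_integral_mono) (auto split: split_indicator simp: potential_mono)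

lemma interaction_cmult:
  assumes "0 \<le> c" and [measurable]: "E \<in> sets lebesgue" "F \<in> sets lebesgue"
  shows "interaction (\<lambda>z. c * K z) E F = ennreal c * interaction K E F"
proof -
  have "potential (\<lambda>z. c * K z) F x = ennreal c * potential K F x" for x
    unfolding potential_def using \<open>0 \<le> c\<close>
    by (subst nn_integral_cmult[symmetric]) (auto simp: ennreal_mult' mult.assoc)
  then show ?thesis
    unfolding interaction_eq_potential by (simp add: nn_integral_cmult mult.assoc)
qed

lemma interaction_commute:
  assumes [measurable]: "E \<in> sets lebesgue" "F \<in> sets lebesgue"
  shows "interaction K E F = interaction K F E"
proof -
  interpret pair_sigma_finite lebesgue "lebesgue :: 'a measure"
    by (intro pair_sigma_finite.intro sigma_finite_lebesgue)
  have sym: "K (x - y) = K (y - x)" for x y by (rule radial) (rule norm_minus_commute)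
  have m: "(\<lambda>(x, y). ennreal (K (x - y)) * indicator F y * indicator E x)
      \<in> borel_measurable (lebesgue \<Otimes>\<^sub>M lebesgue)" by simp
  have "interaction K E F = (\<integral>\<^sup>+x. (\<integral>\<^sup>+y. ennreal (K (x - y)) * indicator F y * indicator E x \<partial>lebesgue) \<partial>lebesgue)"
    unfolding interaction_def by (intro nn_integral_cong, subst nn_integral_multc) auto
  also have "\<dots> = (\<integral>\<^sup>+y. (\<integral>\<^sup>+x. ennreal (K (x - y)) * indicator F y * indicator E x \<partial>lebesgue) \<partial>lebesgue)"
    using Fubini'[OF m] by simp
  also have "\<dots> = (\<integral>\<^sup>+y. (\<integral>\<^sup>+x. ennreal (K (y - x)) * indicator E x * indicator F y \<partial>lebesgue) \<partial>lebesgue)"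
    by (simp only: sym mult_ac)
  also have "\<dots> = interaction K F E"
    unfolding interaction_def by (intro nn_integral_cong, subst nn_integral_multc) auto
  finally show ?thesis .
qed

lemma interaction_Un_left:
  assumes [measurable]: "E \<in> sets lebesgue" "E' \<in> sets lebesgue" "F \<in> sets lebesgue"
    and "E \<inter> E' = {}"
  shows "interaction K (E \<union> E') F = interaction K E F + interaction K E' F"
  unfolding interaction_eq_potential
  by (rule nn_integral_disjoint_pair) (use assms in auto)

lemma interaction_Un_right:
  assumes "E \<in> sets lebesgue" "F \<in> sets lebesgue" "F' \<in> sets lebesgue" "F \<inter> F' = {}"
  shows "interaction K E (F \<union> F') = interaction K E F + interaction K E F'"
  using assms interaction_Un_left[of F F' E] by (simp add: interaction_commute[of E])

lemma interaction_isometric_involution: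
  fixes f :: "'a \<Rightarrow> 'a"
  assumes dist: "\<And>x y. dist (f x) (f y) = dist x y" and inv: "\<And>x. f (f x) = x"
    and [measurable]: "E \<in> sets lebesgue" "F \<in> sets lebesgue"
  shows "interaction K (f ` E) F = interaction K E (f ` F)"
proof -
  have mem: "x \<in> f ` S \<longleftrightarrow> f x \<in> S" for S x using inv by (auto simp: image_iff) metis
  have m [measurable]: "f ` S \<in> sets lebesgue" if "S \<in> sets lebesgue" for S
  proof -
    have "f ` S = f -` S \<inter> space lebesgue" using mem by auto
    then show ?thesis using measurable_sets[OF measurable_isometric_involution[OF dist inv] that] by simp
  qed
  have pot: "potential K F (f x) = potential K (f ` F) x" for x
  proof -
    have "K (f x - f y) = K (x - y)" for y
      using dist by (intro radial) (simp add: dist_norm)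
    then have "potential K (f ` F) x = (\<integral>\<^sup>+y. ennreal (K (f x - f y)) * indicator F (f y) \<partial>lebesgue)"
      unfolding potential_def by (auto simp: indicator_def mem)
    also have "\<dots> = potential K F (f x)"
      unfolding potential_def by (rule nn_integral_isometric_involution[OF dist inv]) simp
    finally show ?thesis by simp
  qed
  have "interaction K (f ` E) F = (\<integral>\<^sup>+x. potential K F (f x) * indicator (f ` E) (f x) \<partial>lebesgue)"
    unfolding interaction_eq_potential
    by (rule nn_integral_isometric_involution[OF dist inv, symmetric]) simp
  also have "\<dots> = interaction K E (f ` F)"
    unfolding interaction_eq_potential pot by (auto simp: indicator_def mem inv)
  finally show ?thesis .
qed

end

section \<open>Riesz kernels and reflections in hyperplanes\<close>

definition riesz :: "real \<Rightarrow> 'a::euclidean_space \<Rightarrow> real" where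
  "riesz s z = 1 / norm z powr (real DIM('a) + s)"

interpretation riesz: radial_kernel "riesz s :: 'a::euclidean_space \<Rightarrow> real" for s
  by unfold_locales (auto simp: riesz_def[abs_def])

text \<open>The reflection in the hyperplane \<open>{x. e \<bullet> x = t}\<close>, for a unit vector \<open>e\<close>.\<close>

definition reflection :: "'a::real_inner \<Rightarrow> real \<Rightarrow> 'a \<Rightarrow> 'a" where
  "reflection e t x = x + (2 * (t - e \<bullet> x)) *\<^sub>R e"

context
  fixes e :: "'a::real_inner"
  assumes e: "norm e = 1"
begin

lemma inner_reflection: "e \<bullet> reflection e t x = 2 * t - e \<bullet> x"
  using e by (simp add: reflection_def inner_add_right power2_norm_eq_inner[symmetric])

lemma reflection_involution: "reflection e t (reflection e t x) = x"
  by (simp add: reflection_def[of e t "reflection e t x"] inner_reflection)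
     (simp add: reflection_def scaleR_left_distrib[symmetric])

text \<open>The sign of the last term is what drives every comparison below: for two points on the same side of
the hyperplane, reflecting one of them increases their distance. With \<open>x = 0\<close> this becomes
\<open>norm_reflection\<close>: when the origin lies in the open half-space \<open>{x. e \<bullet> x < t}\<close>, points of that
half-space are closer to the origin than their mirror images.\<close>

lemma norm_diff_reflection:
  "(norm (x - reflection e t y))\<^sup>2 = (norm (x - y))\<^sup>2 + 4 * (t - e \<bullet> x) * (t - e \<bullet> y)"
proof -
  have "e \<bullet> e = 1" using e by (simp add: power2_norm_eq_inner[symmetric])
  then show ?thesis
    unfolding reflection_def power2_norm_eq_inner
    by (simp add: algebra_simps inner_commute)
qed

lemma norm_reflection:
  "(norm (reflection e t x))\<^sup>2 = (norm x)\<^sup>2 + 4 * t * (t - e \<bullet> x)"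
  using norm_diff_reflection[of 0 t x] by simp

lemma dist_reflection: "dist (reflection e t x) (reflection e t y) = dist x y"
proof -
  have "(norm (reflection e t x - reflection e t y))\<^sup>2 = (norm (x - y))\<^sup>2"
    using norm_diff_reflection[of "reflection e t x" t y] norm_diff_reflection[of y t x]
    by (simp add: inner_reflection norm_minus_commute algebra_simps)
  then show ?thesis by (simp add: dist_norm)
qed

lemma reflection_image_iff: "x \<in> reflection e t ` S \<longleftrightarrow> reflection e t x \<in> S"
  using reflection_involution by (auto simp: image_iff) metis

end

lemma reflection_bisector:
  fixes x y :: "'a::real_inner"
  assumes "x \<noteq> y"
  defines "e \<equiv> (x - y) /\<^sub>R norm (x - y)"
  defines "t \<equiv> ((norm x)\<^sup>2 - (norm y)\<^sup>2) / (2 * norm (x - y))"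
  shows "norm e = 1" and "reflection e t y = x" and "reflection e t x = y"
    and "e \<bullet> x = t + norm (x - y) / 2" and "e \<bullet> y = t - norm (x - y) / 2"
proof -
  let ?d = "norm (x - y)"
  have d: "?d > 0" using assms(1) by simp
  show ne: "norm e = 1" using assms(1) by (simp add: e_def)
  have d2: "?d\<^sup>2 = (norm x)\<^sup>2 + (norm y)\<^sup>2 - 2 * (x \<bullet> y)"
    unfolding power2_norm_eq_inner by (simp add: inner_diff inner_commute)
  have t: "t + ?d / 2 = ((norm x)\<^sup>2 - (norm y)\<^sup>2 + ?d\<^sup>2) / (2 * ?d)"
      "t - ?d / 2 = ((norm x)\<^sup>2 - (norm y)\<^sup>2 - ?d\<^sup>2) / (2 * ?d)"
    unfolding t_def using d
    by (simp_all add: add_divide_distrib diff_divide_distrib power2_eq_square)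
  have "e \<bullet> x = ((norm x)\<^sup>2 - x \<bullet> y) / ?d"
    unfolding e_def power2_norm_eq_inner
    by (simp only: inner_scaleR_left inner_diff_left inner_commute[of y x] divide_inverse mult.commute)
  also have "\<dots> = t + ?d / 2"
    unfolding t d2 by (simp add: divide_simps)
  finally show ex: "e \<bullet> x = t + ?d / 2" .
  have "e \<bullet> y = (x \<bullet> y - (norm y)\<^sup>2) / ?d"
    unfolding e_def power2_norm_eq_inner
    by (simp only: inner_scaleR_left inner_diff_left inner_commute[of y x] divide_inverse mult.commute)
  also have "\<dots> = t - ?d / 2"
    unfolding t d2 by (simp add: divide_simps)
  finally show ey: "e \<bullet> y = t - ?d / 2" .
  show "reflection e t y = x"
    unfolding reflection_def ey using d by (simp add: e_def)
  then show "reflection e t x = y"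
    using reflection_involution[OF ne, of t y] by simp
qed

lemma sets_reflection [measurable]:
  fixes e :: "'a::euclidean_space"
  assumes "norm e = 1" "S \<in> sets lebesgue"
  shows "reflection e t ` S \<in> sets lebesgue" "reflection e t -` S \<in> sets lebesgue"
proof -
  have "reflection e t \<in> lebesgue \<rightarrow>\<^sub>M lebesgue"
    by (rule measurable_isometric_involution)
       (simp_all add: assms(1) dist_reflection reflection_involution)
  then show v: "reflection e t -` S \<in> sets lebesgue"
    using measurable_sets[of "reflection e t" lebesgue lebesgue S] assms(2) by simp
  have "reflection e t ` S = reflection e t -` S"
    using reflection_involution[OF assms(1)] by (auto simp: reflection_image_iff[OF assms(1)])
  with v show "reflection e t ` S \<in> sets lebesgue" by simp
qed

lemma emeasure_reflection:
  fixes e :: "'a::euclidean_space"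
  assumes e: "norm e = 1" and S: "S \<in> sets lebesgue"
  shows "emeasure lebesgue (reflection e t ` S) = emeasure lebesgue S"
proof -
  have v: "reflection e t ` S = reflection e t -` S"
    using reflection_involution[OF e] by (auto simp: reflection_image_iff[OF e])
  have "emeasure lebesgue (reflection e t ` S) = (\<integral>\<^sup>+x. indicator (reflection e t ` S) x \<partial>lebesgue)"
    by (rule nn_integral_indicator[symmetric, OF sets_reflection(1)[OF assms]])
  also have "\<dots> = (\<integral>\<^sup>+x. indicator S (reflection e t x) \<partial>lebesgue)"
    by (rule nn_integral_cong) (simp add: reflection_image_iff[OF e] indicator_def)
  also have "\<dots> = (\<integral>\<^sup>+x. indicator S x \<partial>lebesgue)"
    by (rule nn_integral_isometric_involution) (use S in \<open>simp_all add: e dist_reflection reflection_involution\<close>)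
  finally show ?thesis using S by simp
qed

lemma riesz_strict_antimono:
  fixes x y :: "'a::euclidean_space"
  assumes "0 \<le> s" "x \<noteq> 0" "norm x < norm y"
  shows "riesz s y < (riesz s x :: real)"
  unfolding riesz_def using assms
  by (intro divide_strict_left_mono powr_less_mono2 mult_pos_pos) (auto simp: add_pos_nonneg)

text \<open>The two-point inequality. Two sets on the same side of a hyperplane interact more strongly than one
of them does with the mirror image of the other, and strictly so if the latter interaction is
finite and neither set is null: the kernel is strictly decreasing in the distance and reflecting one point increases the distance.\<close>

context
  fixes e :: "'a::euclidean_space" and t s :: real
  assumes e: "norm e = 1" and s: "0 < s"
begin

lemma potential_reflection_le:
  assumes A[measurable]: "A \<in> sets lebesgue" and AH: "A \<subseteq> {x. e \<bullet> x < t}" and b: "e \<bullet> b < t"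
  shows "potential (riesz s) (reflection e t ` A) b \<le> potential (riesz s) A b"
    and "potential (riesz s) (reflection e t ` A) b < \<infinity> \<Longrightarrow> emeasure lebesgue A > 0 \<Longrightarrow> 
         potential (riesz s) (reflection e t ` A) b < potential (riesz s) A b"
proof -
  let ?R = "reflection e t"
  let ?f = "\<lambda>y. ennreal (riesz s (b - ?R y)) * indicator A y"
  let ?g = "\<lambda>y. ennreal (riesz s (b - y)) * indicator A y"
  note [measurable] = sets_reflection(1)[OF e A] measurable_isometric_involution[of "reflection e t",
    OF dist_reflection[OF e] reflection_involution[OF e]]
  have eq: "potential (riesz s) (?R ` A) b = (\<integral>\<^sup>+y. ?f y \<partial>lebesgue)"
  proof -
    have "potential (riesz s) (?R ` A) b = (\<integral>\<^sup>+y. ennreal (riesz s (b - ?R y)) * indicator (?R ` A) (?R y) \<partial>lebesgue)"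
      unfolding potential_def
      by (rule nn_integral_isometric_involution[symmetric]) (simp_all add: e dist_reflection reflection_involution)
    then show ?thesis by (auto simp: indicator_def reflection_image_iff[OF e] reflection_involution[OF e])
  qed
  have lt: "?f y < ?g y" if "y \<in> A" "y \<noteq> b" for y
  proof -
    have "(t - e \<bullet> b) * (t - e \<bullet> y) > 0" using that AH b by auto
    then have "(norm (b - y))\<^sup>2 < (norm (b - ?R y))\<^sup>2"
      unfolding norm_diff_reflection[OF e] by (simp only: mult.assoc)
    then have "norm (b - y) < norm (b - ?R y)" by (simp add: power_less_imp_less_base)
    then have "riesz s (b - ?R y) < riesz s (b - y)"
      using that s by (intro riesz_strict_antimono) auto
    then show ?thesis using that by (auto simp: ennreal_less_iff riesz_def)
  qed
  have ne: "AE y in lebesgue. y \<noteq> b"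
    by (rule AE_I[of _ _ "{b}"]) auto
  have le: "AE y in lebesgue. ?f y \<le> ?g y"
    using ne by eventually_elim (use lt in \<open>force simp: indicator_def\<close>)
  have mf [measurable]: "?f \<in> borel_measurable lebesgue"
    using measurable_compose[of ?R lebesgue lebesgue, OF _ riesz.measurable_kernel[of s b]] by measurable
  show "potential (riesz s) (?R ` A) b \<le> potential (riesz s) A b"
    unfolding eq unfolding potential_def by (rule nn_integral_mono_AE[OF le])
  assume fin: "potential (riesz s) (?R ` A) b < \<infinity>" and pos: "emeasure lebesgue A > 0"
  show "potential (riesz s) (?R ` A) b < potential (riesz s) A b"
    unfolding eq unfolding potential_def
  proof (rule nn_integral_less)
    show "\<not> (AE y in lebesgue. ?g y \<le> ?f y)"
    proof
      assume "AE y in lebesgue. ?g y \<le> ?f y"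
      with ne have "AE y in lebesgue. y \<notin> A"
        by eventually_elim (use lt in \<open>force simp: not_le[symmetric]\<close>)
      then have "emeasure lebesgue A = 0"
        using AE_iff_null_sets[OF A] by auto
      then show False using pos by simp
    qed
  qed (use fin le in \<open>simp_all add: eq\<close>)
qed

lemma interaction_reflection_le:
  assumes A[measurable]: "A \<in> sets lebesgue" and AH: "A \<subseteq> {x. e \<bullet> x < t}" 
    and B[measurable]: "B \<in> sets lebesgue" and BH: "B \<subseteq> {x. e \<bullet> x < t}" 
  shows "interaction (riesz s) B (reflection e t ` A) \<le> interaction (riesz s) B A"
    and "interaction (riesz s) B (reflection e t ` A) < \<infinity> \<Longrightarrow> emeasure lebesgue A > 0 \<Longrightarrow> emeasure lebesgue B > 0 \<Longrightarrow>
      interaction (riesz s) B (reflection e t ` A) < interaction (riesz s) B A"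
proof -
  let ?f = "\<lambda>b. potential (riesz s) (reflection e t ` A) b * indicator B b"
  let ?g = "\<lambda>b. potential (riesz s) A b * indicator B b"
  note [measurable] = sets_reflection(1)[OF e A]
  have le: "?f b \<le> ?g b" for b
    using potential_reflection_le(1)[OF A AH] BH by (auto simp: indicator_def)
  show "interaction (riesz s) B (reflection e t ` A) \<le> interaction (riesz s) B A"
    unfolding interaction_eq_potential by (rule nn_integral_mono) (rule le)
  assume fin: "interaction (riesz s) B (reflection e t ` A) < \<infinity>" 
    and pos: "emeasure lebesgue A > 0" "emeasure lebesgue B > 0"
  show "interaction (riesz s) B (reflection e t ` A) < interaction (riesz s) B A"
    unfolding interaction_eq_potential
  proof (rule nn_integral_less)
    show "\<not> (AE y in lebesgue. ?g y \<le> ?f y)"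
    proof
      assume *: "AE y in lebesgue. ?g y \<le> ?f y"
      have "AE y in lebesgue. ?f y \<noteq> \<infinity>"
        by (rule nn_integral_PInf_AE) (use fin in \<open>simp_all add: interaction_eq_potential less_top\<close>)
      with * have "AE y in lebesgue. y \<notin> B"
      proof eventually_elim
        case (elim y)
        then show ?case
          using potential_reflection_le(2)[OF A AH _ _ pos(1), of y] BH
          by (auto simp: indicator_def less_top split: if_splits)
      qed
      then have "emeasure lebesgue B = 0"
        using AE_iff_null_sets[OF B] by auto
      then show False using pos by simp
    qed
  qed (use fin le in \<open>simp_all add: interaction_eq_potential\<close>)
qed

end

section \<open>Scaling, and finiteness of the fractional perimeter of a ball\<close>

lemma riesz_nonneg: "0 \<le> riesz s z" by (simp add: riesz_def)

lemma riesz_scaleR: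
  fixes z :: "'a::euclidean_space"
  assumes "c > 0"
  shows "riesz s (c *\<^sub>R z) = c powr - (real DIM('a) + s) * riesz s z"
  using assms unfolding riesz_def powr_minus by (simp add: powr_mult divide_inverse)

lemma powr_minus_DIM:
  assumes "c > 0" shows "c ^ n * c powr - (real n + s) = c powr - s"
proof -
  have "c ^ n * c powr - (real n + s) = c powr (real n) * c powr - (real n + s)"
    using assms by (simp add: powr_realpow)
  also have "\<dots> = c powr - s" by (subst powr_add[symmetric]) simp
  finally show ?thesis .
qed

lemma potential_affine:
  fixes c :: real and p :: "'a::euclidean_space"
  assumes c: "c > 0" and F: "F \<in> sets lebesgue" and F': "\<And>y. p + c *\<^sub>R y \<in> F' \<longleftrightarrow> y \<in> F"
    and F'm [measurable]: "F' \<in> sets lebesgue"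
  shows "potential (riesz s) F' (p + c *\<^sub>R x) = ennreal (c powr - s) * potential (riesz s) F x"
proof -
  have [measurable]: "F \<in> sets lebesgue" by fact
  have kernel: "ennreal (riesz s ((p + c *\<^sub>R x) - (p + c *\<^sub>R y))) * indicator F' (p + c *\<^sub>R y) =
      ennreal (c powr - (real DIM('a) + s)) * (ennreal (riesz s (x - y)) * indicator F y)" for y
  proof -
    have "(p + c *\<^sub>R x) - (p + c *\<^sub>R y) = c *\<^sub>R (x - y)" by (simp add: algebra_simps)
    then show ?thesis
      using c by (simp only: riesz_scaleR ennreal_mult'' riesz_nonneg mult.assoc indicator_def F')
  qed
  have "potential (riesz s) F' (p + c *\<^sub>R x) = ennreal (c ^ DIM('a)) * 
     (\<integral>\<^sup>+y. ennreal (riesz s ((p + c *\<^sub>R x) - (p + c *\<^sub>R y))) * indicator F' (p + c *\<^sub>R y) \<partial>lebesgue)"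
    unfolding potential_def using c by (subst nn_integral_lebesgue_affine[where t=p and c=c]) auto
  also have "\<dots> = ennreal (c ^ DIM('a)) * 
     (\<integral>\<^sup>+y. ennreal (c powr - (real DIM('a) + s)) * (ennreal (riesz s (x - y)) * indicator F y) \<partial>lebesgue)"
    using c by (simp only: kernel)
  also have "\<dots> = ennreal (c ^ DIM('a)) * (ennreal (c powr - (real DIM('a) + s)) * potential (riesz s) F x)"
    unfolding potential_def by (subst nn_integral_cmult) auto
  also have "\<dots> = ennreal (c powr - s) * potential (riesz s) F x"
    using c powr_minus_DIM[of c "DIM('a)" s]
    by (simp add: mult.assoc[symmetric] ennreal_mult''[symmetric])
  finally show ?thesis .
qed

lemma interaction_affine:
  fixes c :: real and p :: "'a::euclidean_space"
  assumes c: "c > 0" and [measurable]: "E \<in> sets lebesgue" "F \<in> sets lebesgue" "E' \<in> sets lebesgue" "F' \<in> sets lebesgue"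
    and F': "\<And>y. p + c *\<^sub>R y \<in> F' \<longleftrightarrow> y \<in> F" and E': "\<And>y. p + c *\<^sub>R y \<in> E' \<longleftrightarrow> y \<in> E"
  shows "interaction (riesz s) E' F' = ennreal (c powr (real DIM('a) - s)) * interaction (riesz s) E F"
proof -
  have "interaction (riesz s) E' F' = ennreal (c ^ DIM('a)) * 
     (\<integral>\<^sup>+x. potential (riesz s) F' (p + c *\<^sub>R x) * indicator E' (p + c *\<^sub>R x) \<partial>lebesgue)"
    unfolding interaction_eq_potential using c
    by (subst nn_integral_lebesgue_affine[where t=p and c=c]) auto
  also have "\<dots> = ennreal (c ^ DIM('a)) * 
     (\<integral>\<^sup>+x. ennreal (c powr - s) * (potential (riesz s) F x * indicator E x) \<partial>lebesgue)"
    using c by (simp add: potential_affine[where F=F and F'=F'] F' E' indicator_def mult.assoc)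
  also have "\<dots> = ennreal (c ^ DIM('a)) * (ennreal (c powr - s) * interaction (riesz s) E F)"
    unfolding interaction_eq_potential by (subst nn_integral_cmult) auto
  also have "\<dots> = ennreal (c powr (real DIM('a) - s)) * interaction (riesz s) E F"
    using c by (simp add: mult.assoc[symmetric] ennreal_mult''[symmetric] powr_realpow[symmetric] powr_add[symmetric])
  finally show ?thesis .
qed

text \<open>Comparison with a step function. It is used with dyadic shells, on which power functions of the
distance to a point or to a sphere are comparable to constants.\<close>

lemma nn_integral_finite_by_pieces:
  fixes S :: "nat \<Rightarrow> 'a set" and c :: "nat \<Rightarrow> real"
  assumes S: "\<And>k. S k \<in> sets M" and le: "\<And>x. x \<in> space M \<Longrightarrow> g x \<noteq> 0 \<Longrightarrow> \<exists>k. x \<in> S k \<and> g x \<le> ennreal (c k)"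
    and c: "\<And>k. 0 \<le> c k" and b: "\<And>k. emeasure M (S k) \<le> ennreal (b k)" "\<And>k. 0 \<le> b k" and sum: "summable (\<lambda>k. c k * b k)"
  shows "(\<integral>\<^sup>+x. g x \<partial>M) < \<infinity>"
proof -
  have "(\<integral>\<^sup>+x. g x \<partial>M) \<le> (\<integral>\<^sup>+x. (\<Sum>k. ennreal (c k) * indicator (S k) x) \<partial>M)"
  proof (rule nn_integral_mono)
    fix x assume x: "x \<in> space M"
    show "g x \<le> (\<Sum>k. ennreal (c k) * indicator (S k) x)"
    proof (cases "g x = 0")
      case False
      with le[OF x] obtain k where "x \<in> S k" "g x \<le> ennreal (c k)" by blast
      then have "g x \<le> (\<Sum>i\<in>{k}. ennreal (c i) * indicator (S i) x)" by simp
      also have "\<dots> \<le> (\<Sum>k. ennreal (c k) * indicator (S k) x)"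
        by (rule sum_le_suminf) auto
      finally show ?thesis .
    qed simp
  qed
  also have "\<dots> = (\<Sum>k. \<integral>\<^sup>+x. ennreal (c k) * indicator (S k) x \<partial>M)"
    using S by (intro nn_integral_suminf) auto
  also have "\<dots> = (\<Sum>k. ennreal (c k) * emeasure M (S k))"
    using S by (simp add: nn_integral_cmult_indicator)
  also have "\<dots> \<le> (\<Sum>k. ennreal (c k * b k))"
    using b c by (intro suminf_le) (auto simp: ennreal_mult' intro: mult_left_mono)
  also have "\<dots> < \<infinity>"
    using suminf_ennreal2[of "\<lambda>k. c k * b k"] sum b c by (simp add: ennreal_suminf_neq_top less_top)
  finally show ?thesis .
qed

lemma potential_exterior_finite:
  assumes s: "0 < s"
  shows "potential (riesz s) (- ball (0::'a::euclidean_space) 1) 0 < \<infinity>"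
  unfolding potential_def
proof (rule nn_integral_finite_by_pieces)
  let ?n = "real DIM('a)"
  let ?w = "unit_ball_vol DIM('a)"
  let ?S = "\<lambda>k. ball (0::'a) (2 ^ Suc k)"
  let ?c = "\<lambda>k. (2 ^ k) powr - (?n + s)"
  show "\<exists>k. x \<in> ?S k \<and> ennreal (riesz s (0 - x)) * indicator (- ball 0 1) x \<le> ennreal (?c k)"
    if "ennreal (riesz s (0 - x)) * indicator (- ball 0 1) x \<noteq> 0" for x :: 'a
  proof -
    have x: "1 \<le> norm x" using that by (auto simp: indicator_def split: if_splits)
    obtain m where m: "norm x < 2 ^ m" using real_arch_pow[of 2 "norm x"] by auto
    define k where "k = (LEAST m. norm x < 2 ^ m)"
    have k: "norm x < 2 ^ k" unfolding k_def using m by (rule LeastI)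
    then obtain j where j: "k = Suc j" using x by (cases k) auto
    have "\<not> norm x < 2 ^ j" using not_less_Least[of j "\<lambda>m. norm x < 2 ^ m"] j k_def by simp
    then have "norm x powr - (?n + s) \<le> ?c j"
      using s by (intro powr_mono2') auto
    then have "riesz s (0 - x) \<le> ?c j" unfolding riesz_def powr_minus_divide by simp
    then show ?thesis using k j by (intro exI[of _ j]) (auto simp: indicator_def ennreal_leI)
  qed
  show "emeasure lebesgue (?S k) \<le> ennreal (?w * (2 ^ Suc k) ^ DIM('a))" for k
    by (simp add: emeasure_ball)
  have "?c k * (?w * (2 ^ Suc k) ^ DIM('a)) = ?w * 2 ^ DIM('a) * (2 powr - s) ^ k" for k
  proof -
    have "?c k * (2 ^ k) ^ DIM('a) = (2 ^ k) powr - s"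
      using powr_minus_DIM[of "2 ^ k" "DIM('a)" s] by (simp add: mult.commute)
    also have "\<dots> = (2 powr - s) ^ k"
      by (simp add: powr_realpow[symmetric] powr_powr mult.commute)
    finally show ?thesis by (simp add: power_mult_distrib)
  qed
  moreover have "summable (\<lambda>k. ?w * 2 ^ DIM('a) * (2 powr - s) ^ k)"
    using s by (intro summable_mult summable_geometric) (simp add: powr_less_one)
  ultimately show "summable (\<lambda>k. ?c k * (?w * (2 ^ Suc k) ^ DIM('a)))" by (simp only:)
qed auto

lemma potential_exterior_le:
  fixes x :: "'a::euclidean_space"
  assumes d: "0 < d" and F: "\<And>y. y \<in> F \<Longrightarrow> d \<le> dist x y"
  shows "potential (riesz s) F x \<le> ennreal (d powr - s) * potential (riesz s) (- ball (0::'a) 1) 0"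
proof -
  have "potential (riesz s) F x \<le> potential (riesz s) (- ball x d) x"
    by (rule riesz.potential_mono) (use F in force)
  also have "\<dots> = potential (riesz s) (- ball x d) (x + d *\<^sub>R 0)" by simp
  also have "\<dots> = ennreal (d powr - s) * potential (riesz s) (- ball (0::'a) 1) 0"
    by (rule potential_affine) (use d in \<open>auto simp: dist_norm\<close>)
  finally show ?thesis .
qed

lemma emeasure_shell_le:
  assumes "0 \<le> h" "h \<le> 1"
  shows "emeasure lebesgue (ball (0::'a::euclidean_space) 1 - ball 0 (1 - h)) \<le> ennreal (unit_ball_vol DIM('a) * (real DIM('a) * h))"
proof -
  let ?w = "unit_ball_vol DIM('a)"
  have "emeasure lebesgue (ball (0::'a) 1 - ball 0 (1 - h)) = ennreal (?w - ?w * (1 - h) ^ DIM('a))"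
    using assms by (subst emeasure_Diff) (auto simp: emeasure_ball ennreal_minus)
  also have "\<dots> \<le> ennreal (?w * (real DIM('a) * h))"
  proof (rule ennreal_leI)
    have "1 + real DIM('a) * (- h) \<le> (1 + (- h)) ^ DIM('a)"
      by (rule Bernoulli_inequality) (use assms in auto)
    then have "?w * (1 - (1 - h) ^ DIM('a)) \<le> ?w * (real DIM('a) * h)"
      by (intro mult_left_mono) auto
    then show "?w - ?w * (1 - h) ^ DIM('a) \<le> ?w * (real DIM('a) * h)" by (simp add: algebra_simps)
  qed
  finally show ?thesis .
qed

text \<open>A point of the ball at distance \<open>h\<close> from the sphere has a potential of order \<open>h powr - s\<close> with respect
to the complement. This is integrable since \<open>s < 1\<close>: the shell with \<open>h\<close> of size \<open>2 powr - k\<close> has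
measure of that same size, so the dyadic sum is a geometric series of ratio \<open>2 powr - (1 - s)\<close>.\<close>

lemma interaction_unit_ball_finite:
  assumes s: "0 < s" "s < 1"
  shows "interaction (riesz s) (ball (0::'a::euclidean_space) 1) (- ball 0 1) < \<infinity>"
  unfolding interaction_eq_potential
proof (rule nn_integral_finite_by_pieces)
  let ?w = "unit_ball_vol DIM('a)"
  let ?h = "\<lambda>k. (1/2) ^ k :: real"
  let ?S = "\<lambda>k. ball (0::'a) 1 - ball 0 (1 - ?h k)"
  define T where "T = enn2real (potential (riesz s) (- ball (0::'a) 1) 0)"
  have T: "potential (riesz s) (- ball (0::'a) 1) 0 = ennreal T"
    using potential_exterior_finite[OF s(1), where 'a='a] by (simp add: T_def less_top)
  let ?c = "\<lambda>k. (?h (Suc k)) powr - s * T"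
  show "\<exists>k. x \<in> ?S k \<and> potential (riesz s) (- ball 0 1) x * indicator (ball 0 1) x \<le> ennreal (?c k)"
    if "potential (riesz s) (- ball 0 1) x * indicator (ball 0 1) x \<noteq> 0" for x :: 'a
  proof -
    have x: "norm x < 1" using that by (auto simp: indicator_def split: if_splits)
    then obtain m where m: "?h m < 1 - norm x" using real_arch_pow_inv[of "1 - norm x" "1/2"] by auto
    define k where "k = (LEAST m. ?h m < 1 - norm x)"
    have k: "?h k < 1 - norm x" unfolding k_def using m by (rule LeastI)
    then obtain j where j: "k = Suc j" using x by (cases k) auto
    have "\<not> ?h j < 1 - norm x" using not_less_Least[of j "\<lambda>m. ?h m < 1 - norm x"] j k_def by simp
    then have S: "x \<in> ?S j" using x by auto
    have "potential (riesz s) (- ball 0 1) x \<le> ennreal ((?h (Suc j)) powr - s) * ennreal T"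
      unfolding T[symmetric]
    proof (rule potential_exterior_le)
      fix y :: 'a assume "y \<in> - ball 0 1"
      then have "1 - norm x \<le> dist x y"
        using norm_triangle_ineq2[of y x] by (simp add: dist_norm norm_minus_commute)
      with k j show "?h (Suc j) \<le> dist x y" by simp
    qed simp
    also have "\<dots> = ennreal (?c j)" by (simp add: ennreal_mult' T_def)
    finally show ?thesis using S x by (intro exI[of _ j]) simp
  qed
  show "emeasure lebesgue (?S k) \<le> ennreal (?w * (real DIM('a) * ?h k))" for k
    by (rule emeasure_shell_le) (auto simp: power_le_one)
  have "?c k * (?w * (real DIM('a) * ?h k)) = 2 powr s * T * ?w * real DIM('a) * ((1/2) powr (1 - s)) ^ k" for k
  proof -
    have "(?h (Suc k)) powr - s * ?h k = 2 powr s * ((1/2) powr (1 - s)) ^ k"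
      by (simp add: powr_realpow[symmetric] powr_powr powr_add[symmetric] powr_mult powr_minus powr_divide field_simps powr_diff)
    then show ?thesis by (simp add: mult_ac)
  qed
  moreover have "summable (\<lambda>k. 2 powr s * T * ?w * real DIM('a) * ((1/2) powr (1 - s)) ^ k)"
    using s by (intro summable_mult summable_geometric) (auto intro: powr_less_mono2[of "1 - s" "1/2" 1, simplified])
  ultimately show "summable (\<lambda>k. ?c k * (?w * (real DIM('a) * ?h k)))" by (simp only:)
  show "0 \<le> ?c k" for k by (simp add: T_def)
qed auto

lemma interaction_ball:
  assumes "r > 0"
  shows "interaction (riesz s) (ball (q::'a::euclidean_space) r) (- ball q r) =
     ennreal (r powr (real DIM('a) - s)) * interaction (riesz s) (ball (0::'a) 1) (- ball 0 1)"
  by (rule interaction_affine[where p=q]) (use assms in \<open>auto simp: dist_norm\<close>)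

section \<open>Finiteness of the energy of a minimizer\<close>

lemma capillarity_energy_eq:
  fixes E \<Omega> :: "'a::euclidean_space set"
  assumes "0 \<le> k1" "0 \<le> k2" and sets: "E \<in> sets lebesgue" "\<Omega> \<in> sets lebesgue"
  shows "capillarity_energy (\<lambda>z. k1 * riesz s1 z) (\<lambda>z. k2 * riesz s2 z) \<sigma> (\<lambda>x. 0) \<Omega> E =
    enn2ereal (ennreal k1 * interaction (riesz s1) E (\<Omega> - E)) +
      ereal \<sigma> * enn2ereal (ennreal k2 * interaction (riesz s2) E (- \<Omega>))"
proof -
  have "- E \<inter> \<Omega> = \<Omega> - E" by auto
  moreover have "- \<Omega> \<in> sets lebesgue" using sets.Diff[of UNIV lebesgue \<Omega>] sets by (simp add: Compl_eq_Diff_UNIV)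
  ultimately show ?thesis
    using assms by (simp add: capillarity_energy_def set_lebesgue_integral_def riesz.interaction_cmult
        zero_ereal_def[symmetric])
qed

lemma capillarity_energy_finite:
  fixes E \<Omega> :: "'a::euclidean_space set"
  assumes "0 \<le> k1" "0 \<le> k2" and sets: "E \<in> sets lebesgue" "\<Omega> \<in> sets lebesgue"
    and fin: "interaction (riesz s1) E (\<Omega> - E) < \<infinity>" "interaction (riesz s2) E (- \<Omega>) < \<infinity>"
  shows "capillarity_energy (\<lambda>z. k1 * riesz s1 z) (\<lambda>z. k2 * riesz s2 z) \<sigma> (\<lambda>x. 0) \<Omega> E =
    ereal (k1 * enn2real (interaction (riesz s1) E (\<Omega> - E)) +
      \<sigma> * k2 * enn2real (interaction (riesz s2) E (- \<Omega>)))"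
proof -
  obtain a b where "interaction (riesz s1) E (\<Omega> - E) = ennreal a" "0 \<le> a"
      "interaction (riesz s2) E (- \<Omega>) = ennreal b" "0 \<le> b"
    using fin by (metis ennreal_cases less_irrefl infinity_ennreal_def)
  then show ?thesis
    unfolding capillarity_energy_eq[OF assms(1-4)]
    using assms(1,2) by (simp add: ennreal_mult''[symmetric] enn2ereal_ennreal mult.assoc)
qed

text \<open>The concentric ball with the prescribed volume has finite energy, and the interaction with the
complement of the container is finite for every subset of the container. So a minimizer has finite
energy, and then its first interaction term cannot be infinite.\<close>

lemma minimizer_interaction_finite:
  fixes E :: "'a::euclidean_space set"
  assumes s: "0 < s1" "s1 < 1" "0 < s2" "s2 < 1" and k: "0 < k1" "0 < k2"
    and min: "volume_constrained_minimizer (\<lambda>z. k1 * riesz s1 z) (\<lambda>z. k2 * riesz s2 z) \<sigma> (\<lambda>x. 0) (ball 0 1) E"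
  shows "interaction (riesz s1) E (ball 0 1 - E) < \<infinity>"
proof -
  let ?C = "capillarity_energy (\<lambda>z. k1 * riesz s1 z) (\<lambda>z. k2 * riesz s2 z) \<sigma> (\<lambda>x. 0) (ball (0::'a) 1)"
  let ?w = "unit_ball_vol DIM('a)"
  have E: "E \<in> sets lebesgue" "E \<subseteq> ball 0 1" "emeasure lebesgue E < emeasure lebesgue (ball (0::'a) 1)"
      "0 < emeasure lebesgue E"
    and le: "\<And>F. F \<in> sets lebesgue \<Longrightarrow> F \<subseteq> ball 0 1 \<Longrightarrow> emeasure lebesgue F = emeasure lebesgue E \<Longrightarrow> ?C E \<le> ?C F"
    using min by (auto simp: volume_constrained_minimizer_def)
  have ext: "interaction (riesz s2) F (- ball 0 1) < \<infinity>" if "F \<subseteq> ball (0::'a) 1" for F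
    using riesz.interaction_mono[OF that order_refl] interaction_unit_ball_finite[OF s(3,4)]
    by (rule order.strict_trans1)
  obtain v where v: "emeasure lebesgue E = ennreal v" "0 < v" "v < ?w"
  proof -
    have "emeasure lebesgue E < ennreal ?w" using E(3) by (simp add: emeasure_ball)
    moreover from this obtain v where "emeasure lebesgue E = ennreal v" "0 \<le> v"
      by (metis ennreal_cases ennreal_less_top less_top order.strict_trans)
    ultimately show ?thesis using that E(4) by (auto simp: ennreal_less_iff)
  qed
  define r where "r = root DIM('a) (v / ?w)"
  have r: "0 < r" "r < 1" "?w * r ^ DIM('a) = v"
    using v by (simp_all add: r_def real_root_pow_pos2 real_root_gt_zero)
  have B: "emeasure lebesgue (ball (0::'a) r) = emeasure lebesgue E"
    using r v by (simp add: emeasure_ball)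
  have sub: "ball (0::'a) r \<subseteq> ball 0 1" using r by auto
  have "interaction (riesz s1) (ball (0::'a) r) (ball 0 1 - ball 0 r) \<le> interaction (riesz s1) (ball (0::'a) r) (- ball 0 r)"
    by (rule riesz.interaction_mono) auto
  also have "\<dots> < \<infinity>"
    using interaction_unit_ball_finite[OF s(1,2), where 'a='a]
    by (simp add: interaction_ball[OF r(1)] ennreal_mult_less_top)
  finally have "?C (ball 0 r) \<noteq> \<infinity>"
    using k ext[OF sub] by (subst capillarity_energy_finite) auto
  moreover have "?C E \<le> ?C (ball 0 r)" using le[OF _ sub B] by simp
  ultimately have "?C E \<noteq> \<infinity>" by auto
  then show ?thesis
    using ext[OF E(2)] k E(1)
    by (auto simp: capillarity_energy_eq ennreal_mult_eq_top_iff less_top[symmetric] ennreal_top_mult)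
qed

section \<open>Polarization lowers the energy when the exponents agree\<close>

text \<open>Polarization with respect to the half-space \<open>H = {x. e \<bullet> x < t}\<close>, which contains the origin. With
\<open>F = ball 0 1 - E\<close>, the set \<open>B\<close> consists of the points of \<open>E\<close> in \<open>H\<close> whose mirror image lies in \<open>F\<close>;
moving \<open>B\<close> across the hyperplane moves part of \<open>F\<close> towards the origin and keeps the volume. \<open>A\<close>
consists of the points of \<open>F\<close> in \<open>H\<close> whose mirror image is not in \<open>F\<close>.

Up to a constant, the energy for \<open>l = k1\<close> is \<open>k1\<close> times the fractional perimeter of \<open>F\<close>, and for
larger \<open>l\<close> there is an additional term \<open>(l - k1) * I F (- ball 0 1)\<close>, where \<open>I\<close> is the interaction.
Decomposing all sets into parts that are invariant under the reflection \<open>R\<close> and parts that are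
exchanged with their mirror images, everything cancels from the energy difference except
\<open>2 * k1 * (I B A - I B (R ` A)) + (l - k1) * (I B Q - I B (R ` Q))\<close>, where \<open>Q\<close> is the set of points of
the unit ball that \<open>R\<close> maps outside the ball. Both differences are nonnegative by the two-point
inequality, and the first is positive unless \<open>A\<close> or \<open>B\<close> is null.\<close>

lemma polarization_energy_decrease:
  fixes e :: "'a::euclidean_space" and E :: "'a set"
  assumes e: "norm e = 1" and s: "0 < s" "s < 1" and t: "0 < t"
    and E: "E \<in> sets lebesgue" and E1: "E \<subseteq> ball 0 1"
    and fin: "interaction (riesz s) E (ball 0 1 - E) < \<infinity>"
  defines "A \<equiv> {x \<in> ball 0 1 - E. e \<bullet> x < t \<and> reflection e t x \<notin> ball 0 1 - E}"
    and "B \<equiv> {x \<in> E. e \<bullet> x < t \<and> reflection e t x \<in> ball 0 1 - E}"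
  defines "E' \<equiv> (E - B) \<union> reflection e t ` B"
  shows "A \<in> sets lebesgue" "B \<in> sets lebesgue"
    and "E' \<in> sets lebesgue" "E' \<subseteq> ball 0 1" "emeasure lebesgue E' = emeasure lebesgue E"
    and "interaction (riesz s) E' (ball 0 1 - E') < \<infinity>"
    and "\<lbrakk>emeasure lebesgue A > 0; emeasure lebesgue B > 0; 0 < k1; k1 \<le> l\<rbrakk> \<Longrightarrow>
      k1 * enn2real (interaction (riesz s) E' (ball 0 1 - E')) - l * enn2real (interaction (riesz s) E' (- ball 0 1))
      < k1 * enn2real (interaction (riesz s) E (ball 0 1 - E)) - l * enn2real (interaction (riesz s) E (- ball 0 1))"
proof -
  define R where "R = reflection e t"
  define \<Omega> where "\<Omega> = ball (0::'a) 1"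
  define F where "F = \<Omega> - E"
  define G where "G = {x \<in> F. R x \<in> F}"
  define Z where "Z = - (G \<union> A \<union> R ` A \<union> B \<union> R ` B)"
  define W where "W = {x. x \<notin> \<Omega> \<and> R x \<notin> \<Omega>}"
  define Q where "Q = {x \<in> \<Omega>. R x \<notin> \<Omega>}"
  define X where "X = F - R ` B"
  define Y where "Y = - (X \<union> B \<union> R ` B)"
  let ?I = "interaction (riesz s) :: 'a set \<Rightarrow> 'a set \<Rightarrow> ennreal"
  have RR [simp]: "R (R x) = x" for x unfolding R_def by (rule reflection_involution[OF e])
  have mem [simp]: "x \<in> R ` S \<longleftrightarrow> R x \<in> S" for x S unfolding R_def by (rule reflection_image_iff[OF e])
  have inj [simp]: "R x = R y \<longleftrightarrow> x = y" for x y by (metis RR)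
  have eR [simp]: "e \<bullet> R x = 2 * t - e \<bullet> x" for x unfolding R_def by (rule inner_reflection[OF e])
  have nlt: "norm x < norm (R x)" if "e \<bullet> x < t" for x
  proof -
    have "0 < t * (t - e \<bullet> x)" using that t by simp
    then have "(norm x)\<^sup>2 < (norm (R x))\<^sup>2"
      unfolding R_def norm_reflection[OF e] by (simp add: mult.assoc)
    then show ?thesis by (rule power_less_imp_less_base) simp
  qed
  have ngt: "norm (R x) < norm x" if "t < e \<bullet> x" for x
    using nlt[of "R x"] that by simp
  have fixed: "R x = x" if "e \<bullet> x = t" for x using that by (simp add: R_def reflection_def)
  have inner: "R x \<in> \<Omega>" if "x \<in> \<Omega>" "t \<le> e \<bullet> x" for x
    using ngt[of x] fixed[of x] that by (cases "e \<bullet> x = t") (auto simp: \<Omega>_def)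
  have A: "x \<in> A \<longleftrightarrow> x \<in> F \<and> e \<bullet> x < t \<and> R x \<notin> F" for x
    by (auto simp: A_def F_def \<Omega>_def R_def)
  have B: "x \<in> B \<longleftrightarrow> x \<in> E \<and> e \<bullet> x < t \<and> R x \<in> F" for x
    by (auto simp: B_def F_def \<Omega>_def R_def)
  have E'eq: "E' = (E - B) \<union> R ` B" by (simp add: E'_def R_def)
  have EF: "E \<inter> F = {}" "E \<union> F = \<Omega>" using E1 by (auto simp: F_def \<Omega>_def)
  have half: "{x. e \<bullet> x < t} \<in> sets lebesgue" using open_halfspace_lt[of e t] by simp
  have Rm: "R ` S \<in> sets lebesgue" if "S \<in> sets lebesgue" for S
    unfolding R_def by (rule sets_reflection(1)[OF e that])
  have \<Omega>m: "\<Omega> \<in> sets lebesgue" by (simp add: \<Omega>_def)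
  have Fm: "F \<in> sets lebesgue" unfolding F_def using \<Omega>m E by simp
  have compl: "- S \<in> sets lebesgue" if "S \<in> sets lebesgue" for S :: "'a set"
    using sets.Diff[of UNIV lebesgue S] that by (simp add: Compl_eq_Diff_UNIV)
  have Aeq: "A = F \<inter> {x. e \<bullet> x < t} \<inter> - R ` F" by (auto simp: A)
  have Beq: "B = E \<inter> {x. e \<bullet> x < t} \<inter> R ` F" by (auto simp: B)
  show mA: "A \<in> sets lebesgue" unfolding Aeq by (intro sets.Int compl half Rm Fm)
  show mB: "B \<in> sets lebesgue" unfolding Beq by (intro sets.Int half Rm Fm E)
  have "G = F \<inter> R ` F" "W = - \<Omega> \<inter> - R ` \<Omega>" "Q = \<Omega> \<inter> - R ` \<Omega>"
    by (auto simp: G_def W_def Q_def)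
  then have m1: "G \<in> sets lebesgue" "W \<in> sets lebesgue" "Q \<in> sets lebesgue"
    by (simp_all only: sets.Int compl Rm Fm \<Omega>m)
  have m2: "X \<in> sets lebesgue" "E - B \<in> sets lebesgue" "R ` B \<in> sets lebesgue" "R ` A \<in> sets lebesgue" "R ` Q \<in> sets lebesgue"
    using E unfolding X_def by (auto intro!: sets.Diff Rm Fm mB mA m1)
  have m3: "Y \<in> sets lebesgue" "Z \<in> sets lebesgue" "- \<Omega> \<in> sets lebesgue"
    unfolding Y_def Z_def by (intro sets.Un compl m1 m2 mA mB \<Omega>m)+
  note ms [simp] = \<Omega>m Fm mA mB m1 m2 m3 E
  show mE': "E' \<in> sets lebesgue" unfolding E'eq by (intro sets.Un m2)
  note mE' [simp]
  have RB: "R ` B \<subseteq> F" "R ` B \<inter> E = {}" using B EF by auto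
  show "E' \<subseteq> ball 0 1" using E1 RB EF by (auto simp: E'eq \<Omega>_def)
  have BE: "B \<subseteq> E" using B by auto
  have "emeasure lebesgue E' = emeasure lebesgue (E - B) + emeasure lebesgue (R ` B)"
    unfolding E'eq using RB by (intro plus_emeasure[symmetric]) auto
  also have "\<dots> = emeasure lebesgue (E - B) + emeasure lebesgue B"
    unfolding R_def by (simp only: emeasure_reflection[OF e mB])
  also have "\<dots> = emeasure lebesgue ((E - B) \<union> B)"
    by (intro plus_emeasure) auto
  also have "(E - B) \<union> B = E" using BE by auto
  finally show "emeasure lebesgue E' = emeasure lebesgue E" .

  have swap: "?I (R ` S) T = ?I S (R ` T)" if "S \<in> sets lebesgue" "T \<in> sets lebesgue" for S T
    using that by (intro riesz.interaction_isometric_involution)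
      (simp_all add: R_def dist_reflection[OF e] reflection_involution[OF e])
  have comm: "?I S T = ?I T S" if "S \<in> sets lebesgue" "T \<in> sets lebesgue" for S T
    using that by (rule riesz.interaction_commute)
  have right: "?I S U = ?I S T + ?I S T'"
    if "U = T \<union> T'" "T \<inter> T' = {}" "S \<in> sets lebesgue" "T \<in> sets lebesgue" "T' \<in> sets lebesgue" for S T T' U
    unfolding that(1) by (rule riesz.interaction_Un_right) (use that in auto)
  have left: "?I U S = ?I T S + ?I T' S"
    if "U = T \<union> T'" "T \<inter> T' = {}" "S \<in> sets lebesgue" "T \<in> sets lebesgue" "T' \<in> sets lebesgue" for S T T' U
    unfolding that(1) by (rule riesz.interaction_Un_left) (use that in auto)

  \<comment> \<open>The complement of \<open>F\<close> outside \<open>B\<close> is \<open>Y\<close>; \<open>G\<close>, \<open>Z\<close> and \<open>W\<close> are the reflection-invariant parts of \<open>X\<close>, \<open>Y\<close> and \<open>- \<Omega>\<close>.\<close>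
  have Xeq: "X = G \<union> A"
  proof (intro set_eqI iffI)
    fix x assume x: "x \<in> X"
    show "x \<in> G \<union> A"
    proof (cases "e \<bullet> x < t")
      case True then show ?thesis using x by (auto simp: X_def G_def A)
    next
      case False
      then have "R x \<in> \<Omega>" using inner[of x] x EF by (auto simp: X_def)
      moreover have "R x = x" if "\<not> t < e \<bullet> x" using fixed False that by simp
      ultimately show ?thesis using x False EF by (cases "t < e \<bullet> x") (auto simp: X_def G_def B)
    qed
  next
    fix x assume "x \<in> G \<union> A"
    then show "x \<in> X" using EF by (auto simp: X_def G_def A B)
  qed
  have GA: "G \<inter> A = {}" by (auto simp: G_def A)
  have RQ: "- \<Omega> = W \<union> R ` Q" "W \<inter> R ` Q = {}" by (auto simp: W_def Q_def)
  have QH: "Q \<subseteq> {x. e \<bullet> x < t}" using inner by (force simp: Q_def not_less[symmetric])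
  have AH: "A \<subseteq> {x. e \<bullet> x < t}" "B \<subseteq> {x. e \<bullet> x < t}" using A B by auto
  have Yeq: "Y = Z \<union> R ` A" "Z \<inter> R ` A = {}"
    using EF unfolding Y_def Xeq Z_def by (auto simp: G_def A B)
  have Y': "Y = (E - B) \<union> - \<Omega>" "(E - B) \<inter> - \<Omega> = {}"
  proof -
    have "X \<union> R ` B = F" unfolding X_def using RB(1) by (metis Diff_partition Un_commute)
    then have "Y = - (F \<union> B)" unfolding Y_def by (metis Un_assoc Un_commute)
    then show "Y = (E - B) \<union> - \<Omega>" using EF BE by fast
    show "(E - B) \<inter> - \<Omega> = {}" using EF(2) by fast
  qed
  have sym: "R ` G = G" "R ` Z = Z" "R ` W = W" by (auto simp: G_def Z_def W_def)

  have EFI: "?I E F = ?I (E - B) X + ?I (E - B) (R ` B) + (?I B X + ?I B (R ` B))"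
  proof -
    have F: "F = X \<union> R ` B" "X \<inter> R ` B = {}" using RB by (auto simp: X_def)
    have "?I E F = ?I (E - B) F + ?I B F" by (rule left) (use BE in auto)
    then show ?thesis by (simp add: right[OF F])
  qed
  have E'c: "\<Omega> - E' = X \<union> B" using EF RB BE by (auto simp: E'eq X_def)
  have E'FI: "?I E' (\<Omega> - E') = ?I (E - B) X + ?I (E - B) B + (?I (R ` B) X + ?I B (R ` B))"
  proof -
    have "?I E' (\<Omega> - E') = ?I (E - B) (\<Omega> - E') + ?I (R ` B) (\<Omega> - E')"
      by (rule left[OF E'eq]) (use RB in auto)
    moreover have "X \<inter> B = {}" using BE EF by (auto simp: X_def)
    ultimately show ?thesis by (simp add: right[OF E'c] comm[of "R ` B" B])
  qed
  have EO: "?I E (- \<Omega>) = ?I (E - B) (- \<Omega>) + ?I B (- \<Omega>)"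
    by (rule left) (use BE in auto)
  have E'O: "?I E' (- \<Omega>) = ?I (E - B) (- \<Omega>) + ?I (R ` B) (- \<Omega>)"
    by (rule left[OF E'eq]) (use RB in auto)
  have BX: "?I B X = ?I B G + ?I B A" by (rule right[OF Xeq GA]) auto
  have RBX: "?I (R ` B) X = ?I B G + ?I B (R ` A)"
    by (subst right[OF Xeq GA]) (auto simp: swap sym)
  have BY: "?I B Y = ?I B Z + ?I B (R ` A)" by (rule right[OF Yeq]) auto
  have RBY: "?I (R ` B) Y = ?I B Z + ?I B A"
  proof -
    have "R ` R ` A = A" by auto
    then show ?thesis by (subst right[OF Yeq]) (auto simp: swap sym)
  qed
  have BY': "?I B Y = ?I (E - B) B + ?I B (- \<Omega>)"
    by (subst right[OF Y']) (auto simp: comm[of B "E - B"])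
  have RBY': "?I (R ` B) Y = ?I (E - B) (R ` B) + ?I (R ` B) (- \<Omega>)"
    by (subst right[OF Y']) (auto simp: comm[of "R ` B" "E - B"])
  have BO: "?I B (- \<Omega>) = ?I B W + ?I B (R ` Q)" by (rule right[OF RQ]) auto
  have RBO: "?I (R ` B) (- \<Omega>) = ?I B W + ?I B Q"
  proof -
    have "R ` R ` Q = Q" by auto
    then show ?thesis by (subst right[OF RQ]) (auto simp: swap sym)
  qed

  have fEF: "?I E F < \<infinity>" using fin by (simp add: F_def \<Omega>_def)
  have fO: "?I S (- \<Omega>) < \<infinity>" if "S \<subseteq> \<Omega>" for S
    using riesz.interaction_mono[OF that order_refl, of s "- \<Omega>"] interaction_unit_ball_finite[OF s, where 'a='a]
    unfolding \<Omega>_def by (rule order.strict_trans1)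
  have f1: "?I (E - B) X < \<infinity>" "?I (E - B) (R ` B) < \<infinity>" "?I B G < \<infinity>" "?I B A < \<infinity>" "?I B (R ` B) < \<infinity>"
    using fEF unfolding EFI BX by auto
  \<comment> \<open>The remaining terms could be infinite a priori; each is bounded through the identities above.\<close>
  have le1: "?I B (R ` A) \<le> ?I B A" and le2: "?I B (R ` Q) \<le> ?I B Q"
    unfolding R_def using AH QH by (auto intro!: interaction_reflection_le(1)[OF e s(1)])
  have f2: "?I B (R ` A) < \<infinity>" using le1 f1(4) by (rule order.strict_trans1)
  have f3: "?I (E - B) (- \<Omega>) < \<infinity>" "?I B (- \<Omega>) < \<infinity>" "?I (R ` B) (- \<Omega>) < \<infinity>"
    by (rule fO, use EF(2) BE RB(1) in fast)+
  have f4: "?I B W < \<infinity>" "?I B Q < \<infinity>" "?I B (R ` Q) < \<infinity>" using f3 unfolding BO RBO by auto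
  have f5: "?I B Z < \<infinity>" using RBY RBY' f1 f3 by (metis ennreal_add_less_top infinity_ennreal_def)
  have f6: "?I (E - B) B < \<infinity>" using BY BY' f5 f2 by (metis ennreal_add_less_top infinity_ennreal_def)
  show "?I E' (ball 0 1 - E') < \<infinity>"
    using E'FI RBX f1 f2 f6 by (simp add: \<Omega>_def)

  assume pos: "emeasure lebesgue A > 0" "emeasure lebesgue B > 0" and k: "0 < k1" "k1 \<le> l"
  have lt: "?I B (R ` A) < ?I B A"
    using f2 AH pos unfolding R_def by (intro interaction_reflection_le(2)[OF e s(1)]) auto
  let ?J = "\<lambda>S T. enn2real (?I S T)"
  have add: "enn2real (a + b) = enn2real a + enn2real b" if "a < \<infinity>" "b < \<infinity>" for a b
    using that by (simp add: enn2real_plus)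
  have J: "?J B (R ` A) < ?J B A" using lt f1(4) by (simp add: enn2real_less_iff less_top enn2real_mono)
  have J2: "?J B (R ` Q) \<le> ?J B Q" using le2 f4 by (simp add: enn2real_mono)
  have r1: "?J E F = ?J (E - B) X + ?J (E - B) (R ` B) + (?J B G + ?J B A + ?J B (R ` B))"
    unfolding EFI BX using f1 by (simp add: add)
  have r2: "?J E' (\<Omega> - E') = ?J (E - B) X + ?J (E - B) B + (?J B G + ?J B (R ` A) + ?J B (R ` B))"
    unfolding E'FI RBX using f1 f2 f6 by (simp add: add)
  have r3: "?J E (- \<Omega>) = ?J (E - B) (- \<Omega>) + (?J B W + ?J B (R ` Q))"
    unfolding EO BO using f3 f4 by (simp add: add)
  have r4: "?J E' (- \<Omega>) = ?J (E - B) (- \<Omega>) + (?J B W + ?J B Q)"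
    unfolding E'O RBO using f3 f4 by (simp add: add)
  have r5: "?J B Z + ?J B (R ` A) = ?J (E - B) B + (?J B W + ?J B (R ` Q))"
    using arg_cong[OF trans[OF BY[symmetric] BY'], of enn2real] f1 f2 f3 f4 f5 f6 by (simp add: add BO)
  have r6: "?J B Z + ?J B A = ?J (E - B) (R ` B) + (?J B W + ?J B Q)"
    using arg_cong[OF trans[OF RBY[symmetric] RBY'], of enn2real] f1 f2 f3 f4 f5 f6 by (simp add: add RBO)
  have "(k1 * ?J E F - l * ?J E (- \<Omega>)) - (k1 * ?J E' (\<Omega> - E') - l * ?J E' (- \<Omega>))
     = k1 * (?J E F - ?J E' (\<Omega> - E')) + l * (?J B Q - ?J B (R ` Q))"
    unfolding r3 r4 by (simp add: algebra_simps)
  also have "?J E F - ?J E' (\<Omega> - E') = 2 * (?J B A - ?J B (R ` A)) - (?J B Q - ?J B (R ` Q))"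
  proof -
    have "ef - ef' = 2 * (ba - bra) - (bq - brq)"
      if "ef = yx + yrb + (bg + ba + brb)" "ef' = yx + yb + (bg + bra + brb)"
        "bz + bra = yb + (bw + brq)" "bz + ba = yrb + (bw + bq)"
      for ef ef' yx yrb bg ba brb yb bra bz bw brq bq :: real
      using that by algebra
    from this[OF r1 r2 r5 r6] show ?thesis .
  qed
  also have "k1 * \<dots> + l * (?J B Q - ?J B (R ` Q)) =
      2 * k1 * (?J B A - ?J B (R ` A)) + (l - k1) * (?J B Q - ?J B (R ` Q))"
    by (simp add: algebra_simps)
  also have "\<dots> > 0"
    using k J J2 by (intro add_pos_nonneg mult_pos_pos mult_nonneg_nonneg) auto
  finally show "k1 * ?J E' (ball 0 1 - E') - l * ?J E' (- ball 0 1)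
      < k1 * ?J E (ball 0 1 - E) - l * ?J E (- ball 0 1)"
    by (simp add: F_def \<Omega>_def)
qed

section \<open>A vacant boundary point forces the minimizer to be null\<close>

text \<open>The hypothesis \<open>k1 \<le> - \<sigma> * k2\<close> covers the equality case: there the energy is, up to a factor and a
constant, the fractional perimeter of the complement of \<open>E\<close> in the ball, and rigidity comes from the strictness in the two-point inequality.\<close>

lemma minimizer_polarization_dichotomy:
  fixes e :: "'a::euclidean_space" and E :: "'a set"
  assumes e: "norm e = 1" and s: "0 < s" "s < 1" and t: "0 < t"
    and k: "0 < k1" "0 < k2" "k1 \<le> - \<sigma> * k2"
    and min: "volume_constrained_minimizer (\<lambda>z. k1 * riesz s z) (\<lambda>z. k2 * riesz s z) \<sigma> (\<lambda>x. 0) (ball 0 1) E"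
    and A: "\<not> negligible {x \<in> ball 0 1 - E. e \<bullet> x < t \<and> reflection e t x \<notin> ball 0 1 - E}" (is "\<not> negligible ?A")
  shows "negligible {x \<in> E. e \<bullet> x < t \<and> reflection e t x \<in> ball 0 1 - E}" (is "negligible ?B")
proof (rule ccontr)
  assume B: "\<not> negligible ?B"
  have E: "E \<in> sets lebesgue" "E \<subseteq> ball 0 1"
    using min by (auto simp: volume_constrained_minimizer_def)
  note fin = minimizer_interaction_finite[OF s s k(1,2) min]
  define E' where "E' = (E - ?B) \<union> reflection e t ` ?B"
  note pol = polarization_energy_decrease[OF e s t E fin, folded E'_def]
  have pos: "emeasure lebesgue ?A > 0" "emeasure lebesgue ?B > 0"
    using A B pol(1,2) by (auto simp: negligible_iff_null_sets null_sets_def zero_less_iff_neq_zero simp del: emeasure_completion)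
  let ?C = "capillarity_energy (\<lambda>z. k1 * riesz s z) (\<lambda>z. k2 * riesz s z) \<sigma> (\<lambda>x. 0) (ball (0::'a) 1)"
  have ext: "interaction (riesz s) F (- ball 0 1) < \<infinity>" if "F \<subseteq> ball (0::'a) 1" for F
    using riesz.interaction_mono[OF that order_refl] interaction_unit_ball_finite[OF s]
    by (rule order.strict_trans1)
  have "?C E \<le> ?C E'"
    using min pol(3-5) by (auto simp: volume_constrained_minimizer_def)
  moreover have "?C E' < ?C E"
    using pol(7)[OF pos k(1,3)] k E pol(3,4,6) fin ext
    by (simp add: capillarity_energy_finite)
  ultimately show False by simp
qed

lemma negligible_reflection:
  fixes e :: "'a::euclidean_space"
  assumes "norm e = 1" "negligible S"
  shows "negligible (reflection e t ` S)"
  using assms sets_reflection(1)[OF assms(1), of S t] emeasure_reflection[OF assms(1), of S t]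
  by (auto simp: negligible_iff_null_sets null_sets_def simp del: emeasure_completion)

text \<open>Near a point \<open>x0\<close> of the unit sphere on the side of the origin, the reflection maps points out of the
unit ball, because it moves them away from the origin. So if \<open>E\<close> is null near \<open>x0\<close>, the first set of
the dichotomy has positive measure, and the second one must be null.\<close>

lemma crescent_not_negligible:
  fixes e x0 :: "'a::euclidean_space"
  assumes e: "norm e = 1" and t: "0 < t" and x0: "norm x0 = 1" "e \<bullet> x0 < t" 
    and "0 < \<epsilon>" and N: "negligible (E \<inter> ball x0 \<epsilon>)"
  shows "\<not> negligible {x \<in> ball 0 1 - E. e \<bullet> x < t \<and> reflection e t x \<notin> ball 0 1 - E}" (is "\<not> negligible ?A")
proof
  assume A: "negligible ?A"
  define V where "V = {x. e \<bullet> x < t} \<inter> {x. 1 < norm (reflection e t x)} \<inter> ball x0 \<epsilon>"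
  have "open V" unfolding V_def reflection_def
    by (intro open_Int open_Collect_less open_ball continuous_intros)
  moreover have "x0 \<in> V"
  proof -
    have "0 < t * (t - e \<bullet> x0)" using x0 t by simp
    then have "1\<^sup>2 < (norm (reflection e t x0))\<^sup>2"
      unfolding norm_reflection[OF e] using x0 by (simp add: mult.assoc)
    then have "1 < norm (reflection e t x0)" by (rule power_less_imp_less_base) simp
    then show ?thesis using x0 \<open>0 < \<epsilon>\<close> by (simp add: V_def)
  qed
  moreover have "x0 \<in> closure (ball 0 1)" using x0 by simp
  ultimately have "V \<inter> ball 0 1 \<noteq> {}" by (metis open_Int_closure_eq_empty IntI empty_iff)
  moreover have "open (V \<inter> ball 0 1)" using \<open>open V\<close> by auto
  moreover have "negligible (V \<inter> ball 0 1)"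
    by (rule negligible_subset[OF negligible_Un[OF A N]]) (auto simp: V_def)
  ultimately show False using open_not_negligible by blast
qed

text \<open>The rest of the argument is geometric: it concerns any subset of the unit ball that satisfies the
dichotomy for every open half-space containing the origin.\<close>

context
  fixes E :: "'a::euclidean_space set"
  assumes E: "E \<subseteq> ball 0 1"
    and pol: "\<And>e t. \<lbrakk>norm e = 1; 0 < t; 
        \<not> negligible {x \<in> ball 0 1 - E. e \<bullet> x < t \<and> reflection e t x \<notin> ball 0 1 - E}\<rbrakk>
      \<Longrightarrow> negligible {x \<in> E. e \<bullet> x < t \<and> reflection e t x \<in> ball 0 1 - E}"
begin

text \<open>The reflection in the bisector of \<open>p\<close> and \<open>p'\<close> exchanges the two balls, but its hyperplane passes
through the origin, where the dichotomy says nothing. It is therefore approximated by the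
hyperplanes at height \<open>t = 1 / (m + 1)\<close>. The point of the sphere required to lie on the side of the
origin is \<open>p'\<close> itself, which already has a smaller vacant ball.\<close>

lemma vacant_ball_moves_along_sphere:
  assumes p: "norm p = 1" "norm p' = 1" and d: "dist p p' < \<epsilon>" and N: "negligible (E \<inter> ball p \<epsilon>)"
  shows "negligible (E \<inter> ball p' \<epsilon>)"
proof (cases "p = p'")
  case False
  define e where "e = (p - p') /\<^sub>R norm (p - p')"
  note bis = reflection_bisector[OF False, folded e_def]
  have e: "norm e = 1" and ep: "e \<bullet> p' = - (norm (p - p') / 2)" and R0: "reflection e 0 p' = p"
    using bis p by auto
  define B where "B m = {x \<in> E. e \<bullet> x < inverse (real (Suc m)) \<and> reflection e (inverse (real (Suc m))) x \<in> ball 0 1 - E}" for m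
  have "negligible (B m)" for m
    unfolding B_def
  proof (rule pol[OF e], simp, rule crescent_not_negligible[OF e _ p(2)])
    show "e \<bullet> p' < inverse (real (Suc m))" 
      using ep by (simp add: order.strict_trans1[of _ 0])
    show "0 < \<epsilon> - dist p p'" using d by simp
    show "negligible (E \<inter> ball p' (\<epsilon> - dist p p'))"
      by (rule negligible_subset[OF N]) (auto intro: order.strict_trans1[OF dist_triangle[of _ _ p']] simp: less_diff_eq add.commute)
  qed simp
  moreover have "negligible (reflection e (inverse (real (Suc m))) ` (E \<inter> ball p \<epsilon>))" for m
    by (rule negligible_reflection[OF e N])
  ultimately have neg: "negligible ((E \<inter> ball p \<epsilon>) \<union> ((\<Union>m. B m) \<union> (\<Union>m. reflection e (inverse (real (Suc m))) ` (E \<inter> ball p \<epsilon>))))"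
    using N by (intro negligible_Un negligible_Union_nat) auto
  show ?thesis
  proof (rule negligible_subset[OF neg], intro subsetI)
    fix x assume x: "x \<in> E \<inter> ball p' \<epsilon>"
    show "x \<in> (E \<inter> ball p \<epsilon>) \<union> ((\<Union>m. B m) \<union> (\<Union>m. reflection e (inverse (real (Suc m))) ` (E \<inter> ball p \<epsilon>)))"
    proof (cases "x \<in> ball p \<epsilon>")
      case False
      then have "dist p' x < dist p x" using x by auto
      then have "(norm (p' - x))\<^sup>2 < (norm (p - x))\<^sup>2" by (simp add: dist_norm power_strict_mono)
      also have "norm (p - x) = norm (x - reflection e 0 p')" by (simp add: R0 norm_minus_commute)
      also have "\<dots>\<^sup>2 = (norm (p' - x))\<^sup>2 + 4 * (e \<bullet> x) * (e \<bullet> p')"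
        using norm_diff_reflection[OF e, of x 0 p'] by (simp add: norm_minus_commute)
      finally have "e \<bullet> x * (norm (p - p') / 2) < 0" using ep by simp
      then have ex: "e \<bullet> x < 0" using \<open>p \<noteq> p'\<close> by (simp add: mult_less_0_iff)
      define y where "y = reflection e 0 x"
      have y: "dist p y < \<epsilon>" "norm y < 1"
      proof -
        have "dist p y = dist p' x" unfolding y_def R0[symmetric] by (rule dist_reflection[OF e])
        then show "dist p y < \<epsilon>" using x by simp
        have "(norm y)\<^sup>2 = (norm x)\<^sup>2" unfolding y_def by (simp add: norm_reflection[OF e])
        then have "norm y = norm x" by simp
        then show "norm y < 1" using x E by auto
      qed
      obtain m where m: "inverse (real (Suc m)) < min (\<epsilon> - dist p y) (1 - norm y) / 2"
        using reals_Archimedean[of "min (\<epsilon> - dist p y) (1 - norm y) / 2"] y by auto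
      let ?t = "inverse (real (Suc m))"
      have dy: "dist y (reflection e ?t x) = 2 * ?t"
      proof -
        have "y - reflection e ?t x = - (2 * ?t) *\<^sub>R e"
          by (simp add: y_def reflection_def scaleR_diff_left right_diff_distrib)
        then show ?thesis using e by (simp add: dist_norm)
      qed
      have "dist p (reflection e ?t x) < \<epsilon>" "norm (reflection e ?t x) < 1"
        using dist_triangle[of p "reflection e ?t x" y] norm_triangle_ineq2[of "reflection e ?t x" y] dy m
        by (auto simp: dist_norm norm_minus_commute)
      then consider "reflection e ?t x \<in> E \<inter> ball p \<epsilon>" | "reflection e ?t x \<in> ball 0 1 - E" by auto
      then show ?thesis
      proof cases
        case 1
        then have "x \<in> reflection e ?t ` (E \<inter> ball p \<epsilon>)" by (simp only: reflection_image_iff[OF e])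
        then show ?thesis by blast
      next
        case 2
        then have "x \<in> B m" using x ex by (auto simp: B_def intro: order.strict_trans)
        then show ?thesis by blast
      qed
    qed (use x in simp)
  qed
qed (use N in simp)

text \<open>The vacant ball spreads over the whole connected sphere, so \<open>E\<close> is null near every boundary point.
If \<open>E\<close> were not null, the dichotomy would fail for the bisector of a point \<open>q\<close> of its measure-theoretic
support and a point \<open>u\<close> with \<open>norm q < norm u\<close> in the vacant region.\<close>

lemma negligible_if_vacant_ball:
  assumes dim: "2 \<le> DIM('a)" and p0: "norm p0 = 1" and "0 < \<epsilon>" and N0: "negligible (E \<inter> ball p0 \<epsilon>)"
  shows "negligible E"
proof (rule ccontr)
  have all: "negligible (E \<inter> ball p \<epsilon>)" if "norm p = 1" for p
  proof (rule connected_induction_simple[where S = "sphere 0 1" and a = p0 and b = p])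
    show "connected (sphere (0::'a) 1)" using dim by (rule connected_sphere)
    fix a :: 'a assume a: "a \<in> sphere 0 1"
    show "\<exists>T. openin (top_of_set (sphere 0 1)) T \<and> a \<in> T \<and>
        (\<forall>x\<in>T. \<forall>y\<in>T. negligible (E \<inter> ball x \<epsilon>) \<longrightarrow> negligible (E \<inter> ball y \<epsilon>))"
    proof (intro exI[of _ "sphere 0 1 \<inter> ball a (\<epsilon> / 2)"] conjI ballI impI)
      show "openin (top_of_set (sphere 0 1)) (sphere 0 1 \<inter> ball a (\<epsilon> / 2))" by (rule openin_open_Int) simp
      show "a \<in> sphere 0 1 \<inter> ball a (\<epsilon> / 2)" using a \<open>0 < \<epsilon>\<close> by simp
      fix x y assume "x \<in> sphere 0 1 \<inter> ball a (\<epsilon> / 2)" "y \<in> sphere 0 1 \<inter> ball a (\<epsilon> / 2)"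
        and "negligible (E \<inter> ball x \<epsilon>)"
      then show "negligible (E \<inter> ball y \<epsilon>)"
        by (intro vacant_ball_moves_along_sphere[of x y]) (auto intro: dist_triangle_half_r)
    qed
  qed (use p0 N0 that in auto)
  assume "\<not> negligible E"
  then obtain q where q: "q \<in> E" and supp: "\<And>U. openin (top_of_set E) U \<Longrightarrow> q \<in> U \<Longrightarrow> \<not> negligible U"
    unfolding locally_negligible_alt[of E] by blast
  \<comment> \<open>As \<open>c\<close> exceeds \<open>norm q\<close> and \<open>1 - \<epsilon>\<close>, the point \<open>u\<close> is farther from the origin than \<open>q\<close> and lies in the vacant ball.\<close>
  define c where "c = (1 + max (norm q) (1 - \<epsilon>)) / 2"
  have q1: "norm q < 1" using q E by auto
  have c: "norm q < c" "1 - \<epsilon> < c" "c < 1" using q1 \<open>0 < \<epsilon>\<close> by (auto simp: c_def max_def)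
  define u where "u = c *\<^sub>R p0"
  have u: "norm u = c" "dist p0 u = 1 - c"
  proof -
    have "0 < c" using c norm_ge_zero[of q] by linarith
    show "norm u = c" using \<open>0 < c\<close> p0 by (simp add: u_def)
    have "p0 - u = (1 - c) *\<^sub>R p0" by (simp add: u_def scaleR_diff_left)
    then show "dist p0 u = 1 - c" using c p0 by (simp add: dist_norm)
  qed
  have uq: "u \<noteq> q" using u c by auto
  define e where "e = (u - q) /\<^sub>R norm (u - q)"
  define t where "t = ((norm u)\<^sup>2 - (norm q)\<^sup>2) / (2 * norm (u - q))"
  note bis = reflection_bisector[OF uq, folded e_def, folded t_def]
  have "(norm q)\<^sup>2 < (norm u)\<^sup>2" using u c by (simp add: power_strict_mono)
  then have t: "0 < t" using uq by (simp add: t_def)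
  \<comment> \<open>The vacant point on the side of the origin can be taken to be \<open>- e\<close>.\<close>
  have "e \<bullet> (- e) < t" using t bis(1) by (simp add: power2_norm_eq_inner[symmetric])
  then have B: "negligible {x \<in> E. e \<bullet> x < t \<and> reflection e t x \<in> ball 0 1 - E}" (is "negligible ?B")
    using bis(1) t \<open>0 < \<epsilon>\<close> by (intro pol crescent_not_negligible[of e t "- e" \<epsilon>] all) auto
  define r where "r = min (norm (u - q) / 2) (min (\<epsilon> - (1 - c)) (1 - c))"
  have r: "0 < r" "r \<le> norm (u - q) / 2" "r \<le> \<epsilon> - (1 - c)" "r \<le> 1 - c"
    unfolding r_def using uq c by (auto intro: min.coboundedI1 min.coboundedI2 simp del: min.bounded_iff min_less_iff_disj le_divide_eq_numeral1)
  have "E \<inter> ball q r \<subseteq> ?B \<union> reflection e t ` (E \<inter> ball p0 \<epsilon>)"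
  proof
    fix x assume x: "x \<in> E \<inter> ball q r"
    have "e \<bullet> (x - q) \<le> norm e * norm (x - q)" by (rule norm_cauchy_schwarz)
    also have "\<dots> < norm (u - q) / 2" using x r bis(1) by (simp add: dist_norm norm_minus_commute)
    finally have ex: "e \<bullet> x < t" using bis(5) by (simp add: inner_diff_right)
    have Rx: "dist u (reflection e t x) < r"
      using dist_reflection[OF bis(1), of t q x] bis(2) x by simp
    have "dist p0 (reflection e t x) < \<epsilon>"
      using dist_triangle[of p0 "reflection e t x" u] Rx u r by simp
    moreover have "norm (reflection e t x) < 1"
      using norm_triangle_ineq2[of "reflection e t x" u] Rx u r by (simp add: dist_norm norm_minus_commute)
    ultimately show "x \<in> ?B \<union> reflection e t ` (E \<inter> ball p0 \<epsilon>)"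
      using x ex unfolding Un_iff reflection_image_iff[OF bis(1)] by auto
  qed
  then have "negligible (E \<inter> ball q r)"
    using B negligible_reflection[OF bis(1) N0, of t] negligible_subset negligible_Un by blast
  moreover have "openin (top_of_set E) (E \<inter> ball q r)" by (rule openin_open_Int) simp
  ultimately show False using supp[of "E \<inter> ball q r"] q r by auto
qed

end

section \<open>A small ball at the boundary beats any loss in the interior\<close>

text \<open>Fubini, in the form of the symmetry of the interaction for the kernel \<open>indicator (ball 0 r)\<close>.\<close>

lemma nn_integral_emeasure_Int_ball:
  fixes E :: "'a::euclidean_space set"
  assumes [measurable]: "E \<in> sets lebesgue" and "0 \<le> r"
  shows "(\<integral>\<^sup>+q. emeasure lebesgue (E \<inter> ball q r) \<partial>lebesgue)
    = ennreal (unit_ball_vol DIM('a) * r ^ DIM('a)) * emeasure lebesgue E"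
proof -
  let ?K = "indicator (ball (0::'a) r) :: 'a \<Rightarrow> real"
  interpret radial_kernel ?K
    by unfold_locales (rule borel_measurable_indicator, simp, simp add: indicator_def)
  have pot: "potential ?K S q = emeasure lebesgue (S \<inter> ball q r)" if "S \<in> sets lebesgue" for S q
  proof -
    have "potential ?K S q = (\<integral>\<^sup>+y. indicator (S \<inter> ball q r) y \<partial>lebesgue)"
      unfolding potential_def
      by (intro nn_integral_cong) (auto simp: indicator_def dist_norm norm_minus_commute)
    also have "\<dots> = emeasure lebesgue (S \<inter> ball q r)"
      using that by (intro nn_integral_indicator) auto
    finally show ?thesis .
  qed
  have "(\<integral>\<^sup>+q. emeasure lebesgue (E \<inter> ball q r) \<partial>lebesgue) = interaction ?K UNIV E"
    unfolding interaction_eq_potential by (simp only: pot[OF assms(1)] indicator_UNIV mult_1_right)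
  also have "\<dots> = interaction ?K E UNIV" by (rule interaction_commute) auto
  also have "\<dots> = (\<integral>\<^sup>+x. ennreal (unit_ball_vol DIM('a) * r ^ DIM('a)) * indicator E x \<partial>lebesgue)"
    unfolding interaction_eq_potential using assms(2) by (simp add: pot emeasure_ball)
  also have "\<dots> = ennreal (unit_ball_vol DIM('a) * r ^ DIM('a)) * emeasure lebesgue E"
    by (rule nn_integral_cmult_indicator) simp
  finally show ?thesis .
qed

text \<open>A substitute for the Lebesgue density theorem with a scale-independent constant: some ball of radius
\<open>\<rho>\<close> meets \<open>E\<close> in more than half of what a ball of that radius does on average. Restricting \<open>E\<close> to a smaller concentric ball
first keeps these balls away from the unit sphere.\<close>

lemma ex_ball_large_intersection:
  fixes E :: "'a::euclidean_space set"
  assumes E: "E \<in> sets lebesgue" "E \<subseteq> ball 0 1" and pos: "0 < emeasure lebesgue E"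
  obtains \<eta> \<delta> :: real where "0 < \<eta>" "0 < \<delta>"
    "\<And>\<rho>. 0 < \<rho> \<Longrightarrow> \<rho> \<le> \<delta> \<Longrightarrow>
      \<exists>q. ball q \<rho> \<subseteq> ball 0 (1 - \<delta>) \<and> ennreal (\<eta> * \<rho> ^ DIM('a)) \<le> emeasure lebesgue (E \<inter> ball q \<rho>)"
proof -
  let ?n = "DIM('a)"
  have "\<exists>k. \<not> negligible (E \<inter> ball 0 (1 - inverse (real (Suc k))))"
  proof (rule ccontr)
    assume "\<not> ?thesis"
    then have "negligible (\<Union>k. E \<inter> ball 0 (1 - inverse (real (Suc k))))"
      by (intro negligible_Union_nat) auto
    moreover have "E \<subseteq> (\<Union>k. E \<inter> ball 0 (1 - inverse (real (Suc k))))"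
    proof
      fix x assume x: "x \<in> E"
      then obtain k where "inverse (real (Suc k)) < 1 - norm x"
        using E reals_Archimedean[of "1 - norm x"] by force
      then have "x \<in> E \<inter> ball 0 (1 - inverse (real (Suc k)))" using x by auto
      then show "x \<in> (\<Union>k. E \<inter> ball 0 (1 - inverse (real (Suc k))))" by blast
    qed
    ultimately have "negligible E" by (rule negligible_subset)
    then show False using pos by (simp add: negligible_iff_emeasure0[OF E(1)])
  qed
  then obtain k where k: "\<not> negligible (E \<inter> ball 0 (1 - inverse (real (Suc k))))" by blast
  define \<delta> where "\<delta> = inverse (real (Suc k)) / 3"
  have \<delta>: "0 < \<delta>" "\<delta> \<le> 1 / 3" by (auto simp: \<delta>_def divide_simps)
  define E0 where "E0 = E \<inter> ball 0 (1 - 3 * \<delta>)"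
  have E0: "E0 \<in> sets lebesgue" "E0 \<subseteq> ball 0 1" using E by (auto simp: E0_def)
  have "emeasure lebesgue E0 \<noteq> 0"
    using k E0(1) by (simp add: E0_def \<delta>_def negligible_iff_emeasure0)
  moreover have "emeasure lebesgue E0 < \<infinity>"
    using emeasure_mono[OF E0(2), of lebesgue] by (simp add: emeasure_ball order.strict_trans1)
  ultimately obtain v where v: "emeasure lebesgue E0 = ennreal v" "0 < v"
    by (metis ennreal_cases ennreal_0 less_irrefl infinity_ennreal_def order_le_less)
  define \<eta> where "\<eta> = v / (2 * 2 ^ ?n)"
  show thesis
  proof (rule that[of \<eta> \<delta>])
    show "0 < \<eta>" using v by (simp add: \<eta>_def)
    fix \<rho> :: real assume \<rho>: "0 < \<rho>" "\<rho> \<le> \<delta>"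
    let ?w = "unit_ball_vol ?n"
    have "\<exists>q. \<not> emeasure lebesgue (E0 \<inter> ball q \<rho>) \<le> ennreal (\<eta> * \<rho> ^ ?n)"
    proof (rule ccontr)
      assume "\<not> ?thesis"
      then have le: "emeasure lebesgue (E0 \<inter> ball q \<rho>) \<le> ennreal (\<eta> * \<rho> ^ ?n)" for q by blast
      have "ennreal (?w * \<rho> ^ ?n) * ennreal v = (\<integral>\<^sup>+q. emeasure lebesgue (E0 \<inter> ball q \<rho>) \<partial>lebesgue)"
        using \<rho> by (simp only: nn_integral_emeasure_Int_ball[OF E0(1)] v)
      also have "\<dots> \<le> (\<integral>\<^sup>+q. ennreal (\<eta> * \<rho> ^ ?n) * indicator (ball (0::'a) 2) q \<partial>lebesgue)"
      proof (rule nn_integral_mono)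
        fix q :: 'a
        show "emeasure lebesgue (E0 \<inter> ball q \<rho>) \<le> ennreal (\<eta> * \<rho> ^ ?n) * indicator (ball (0::'a) 2) q"
        proof (cases "q \<in> ball 0 2")
          case False
          have "E0 \<inter> ball q \<rho> = {}"
          proof (rule ccontr)
            assume "E0 \<inter> ball q \<rho> \<noteq> {}"
            then obtain x where "x \<in> E0" "dist q x < \<rho>" by auto
            moreover from this have "norm x < 1" using E0(2) by auto
            ultimately show False using False norm_triangle_ineq2[of q x] \<rho> \<delta> by (simp add: dist_norm)
          qed
          then show ?thesis by simp
        qed (use le in simp)
      qed
      also have "\<dots> = ennreal (\<eta> * \<rho> ^ ?n) * ennreal (?w * 2 ^ ?n)"
        by (subst nn_integral_cmult_indicator) (auto simp: emeasure_ball)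
      finally have "?w * \<rho> ^ ?n * v \<le> \<eta> * \<rho> ^ ?n * (?w * 2 ^ ?n)"
        using v \<rho> by (simp add: ennreal_mult''[symmetric] \<eta>_def)
      also have "\<dots> = ?w * \<rho> ^ ?n * v / 2" by (simp add: \<eta>_def)
      finally have "?w * \<rho> ^ ?n * v \<le> 0" by linarith
      moreover have "0 < ?w * \<rho> ^ ?n * v" using v \<rho> by simp
      ultimately show False by simp
    qed
    then obtain q where q: "ennreal (\<eta> * \<rho> ^ ?n) < emeasure lebesgue (E0 \<inter> ball q \<rho>)" by (auto simp: not_le)
    then have "E0 \<inter> ball q \<rho> \<noteq> {}" by (metis emeasure_empty not_less_zero)
    then obtain x where x: "norm x < 1 - 3 * \<delta>" "dist q x < \<rho>" by (auto simp: E0_def)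
    have "ball q \<rho> \<subseteq> ball 0 (1 - \<delta>)"
    proof
      fix y assume "y \<in> ball q \<rho>"
      then show "y \<in> ball 0 (1 - \<delta>)"
        using x \<rho> dist_triangle[of x y q] norm_triangle_ineq2[of y x] by (simp add: dist_norm norm_minus_commute)
    qed
    moreover have "emeasure lebesgue (E0 \<inter> ball q \<rho>) \<le> emeasure lebesgue (E \<inter> ball q \<rho>)"
      using E by (intro emeasure_mono) (auto simp: E0_def)
    ultimately show "\<exists>q. ball q \<rho> \<subseteq> ball 0 (1 - \<delta>) \<and> ennreal (\<eta> * \<rho> ^ ?n) \<le> emeasure lebesgue (E \<inter> ball q \<rho>)"
      using q by (intro exI[of _ q]) auto
  qed (use \<delta> in simp)
qed

text \<open>The ball is internally tangent to the unit sphere at \<open>p\<close>; its mirror image in the tangent plane lies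
outside the unit ball, and any two points of the two balls have distance at most \<open>4 * r\<close>.\<close>

lemma interaction_tangent_ball_ge:
  fixes p :: "'a::euclidean_space"
  assumes p: "norm p = 1" and r: "0 < r" and s: "0 < s"
  shows "ennreal ((unit_ball_vol DIM('a))\<^sup>2 * 4 powr - (real DIM('a) + s) * r powr (real DIM('a) - s))
    \<le> interaction (riesz s) (ball ((1 - r) *\<^sub>R p) r) (- ball 0 1)"
proof -
  let ?n = "DIM('a)" and ?w = "unit_ball_vol DIM('a)"
  let ?A = "ball ((1 - r) *\<^sub>R p) r" and ?B = "ball ((1 + r) *\<^sub>R p) r"
  let ?c = "(4 * r) powr - (real ?n + s)"
  have B1: "y \<in> - ball 0 1" if "y \<in> ?B" for y
    using that norm_triangle_ineq2[of "(1 + r) *\<^sub>R p" y] p r by (auto simp: dist_norm)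
  have AB: "?c \<le> riesz s (x - y)" if "x \<in> ?A" "y \<in> ?B" for x y
  proof (cases "x = y")
    case True
    have "(1 - r) *\<^sub>R p - (1 + r) *\<^sub>R p = - (2 * r) *\<^sub>R p" by (simp add: scaleR_diff_left[symmetric])
    then have "dist ((1 - r) *\<^sub>R p) ((1 + r) *\<^sub>R p) = 2 * r" using p r by (simp add: dist_norm)
    then show ?thesis using that True dist_triangle[of "(1 - r) *\<^sub>R p" "(1 + r) *\<^sub>R p" x] by (simp add: dist_commute)
  next
    case False
    have "(1 - r) *\<^sub>R p - (1 + r) *\<^sub>R p = - (2 * r) *\<^sub>R p" by (simp add: scaleR_diff_left[symmetric])
    then have "dist ((1 - r) *\<^sub>R p) ((1 + r) *\<^sub>R p) = 2 * r" using p r by (simp add: dist_norm)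
    then have "dist x y \<le> 4 * r"
      using that dist_triangle[of x y "(1 - r) *\<^sub>R p"] dist_triangle[of "(1 - r) *\<^sub>R p" y "(1 + r) *\<^sub>R p"]
      by (simp add: dist_commute)
    then have "?c \<le> norm (x - y) powr - (real ?n + s)"
      using s False by (intro powr_mono2') (auto simp: dist_norm)
    then show ?thesis unfolding riesz_def powr_minus_divide by simp
  qed
  have pot: "ennreal (?c * (?w * r ^ ?n)) \<le> potential (riesz s) (- ball 0 1) x" if "x \<in> ?A" for x
  proof -
    have "ennreal (?c * (?w * r ^ ?n)) = (\<integral>\<^sup>+y. ennreal ?c * indicator ?B y \<partial>lebesgue)"
      using r by (subst nn_integral_cmult_indicator) (auto simp: emeasure_ball ennreal_mult'')
    also have "\<dots> \<le> potential (riesz s) (- ball 0 1) x"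
      unfolding potential_def using AB[OF that] B1
      by (intro nn_integral_mono) (auto simp: indicator_def ennreal_leI)
    finally show ?thesis .
  qed
  have "r powr (real ?n - s) = r ^ ?n * (r ^ ?n * r powr - (real ?n + s))"
    using r by (subst powr_minus_DIM) (auto simp: powr_realpow[symmetric] powr_add[symmetric])
  then have "?w\<^sup>2 * 4 powr - (real ?n + s) * r powr (real ?n - s) = ?c * (?w * r ^ ?n) * (?w * r ^ ?n)"
    using r by (simp add: powr_mult power2_eq_square mult_ac)
  then have "ennreal (?w\<^sup>2 * 4 powr - (real ?n + s) * r powr (real ?n - s)) = (\<integral>\<^sup>+x. ennreal (?c * (?w * r ^ ?n)) * indicator ?A x \<partial>lebesgue)"
    using r by (subst nn_integral_cmult_indicator) (auto simp: emeasure_ball ennreal_mult''[symmetric])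
  also have "\<dots> \<le> interaction (riesz s) ?A (- ball 0 1)"
    unfolding interaction_eq_potential using pot by (intro nn_integral_mono) (auto simp: indicator_def)
  finally show ?thesis .
qed

text \<open>Compare \<open>E\<close> with the set obtained by removing \<open>D = E \<inter> ball q \<rho>\<close>, a piece in the interior whose volume
is comparable to \<open>\<rho> ^ n\<close>, and adding the ball \<open>A\<close> of the same volume that is internally tangent to the
sphere at the vacant point \<open>p\<close>. The first interaction grows by at most the fractional perimeters of
the two balls, of order \<open>\<rho> powr (n - s1)\<close>; losing the adhesion of \<open>D\<close> costs only \<open>\<rho> ^ n\<close>; the adhesion of
\<open>A\<close> gains at least a multiple of \<open>\<rho> powr (n - s2)\<close>. For \<open>s1 < s2\<close> and small \<open>\<rho>\<close> the gain prevails.\<close>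

lemma order_le_if_minimizer_vacant:
  fixes p :: "'a::euclidean_space"
  assumes s: "0 < s1" "s1 < 1" "0 < s2" "s2 < 1" and k: "0 < k1" "0 < k2" and sg: "\<sigma> < 0"
    and min: "volume_constrained_minimizer (\<lambda>z. k1 * riesz s1 z) (\<lambda>z. k2 * riesz s2 z) \<sigma> (\<lambda>x. 0) (ball 0 1) E"
    and p: "norm p = 1" and \<epsilon>: "0 < \<epsilon>" "ball p \<epsilon> \<inter> ball 0 1 \<subseteq> ball 0 1 - E"
  shows "s2 \<le> s1"
proof (rule ccontr)
  assume "\<not> s2 \<le> s1"
  let ?n = "DIM('a)"
  let ?w = "unit_ball_vol ?n"
  let ?\<Omega> = "ball (0::'a) 1"
  let ?I1 = "interaction (riesz s1) :: 'a set \<Rightarrow> 'a set \<Rightarrow> ennreal"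
  let ?I2 = "interaction (riesz s2) :: 'a set \<Rightarrow> 'a set \<Rightarrow> ennreal"
  have E: "E \<in> sets lebesgue" "E \<subseteq> ?\<Omega>" "0 < emeasure lebesgue E"
    using min by (auto simp: volume_constrained_minimizer_def)
  note fin = minimizer_interaction_finite[OF s k min]
  have [simp]: "- ?\<Omega> \<in> sets lebesgue" "- ball q r \<in> sets lebesgue" for q :: 'a and r
    using sets.Diff[of UNIV lebesgue "ball q r"] sets.Diff[of UNIV lebesgue ?\<Omega>] by (simp_all add: Compl_eq_Diff_UNIV)
  have ext: "?I2 F (- ?\<Omega>) < \<infinity>" if "F \<subseteq> ?\<Omega>" for F
    using riesz.interaction_mono[OF that order_refl] interaction_unit_ball_finite[OF s(3,4)]
    by (rule order.strict_trans1)
  define P where "P = enn2real (?I1 ?\<Omega> (- ?\<Omega>))"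
  have P: "?I1 ?\<Omega> (- ?\<Omega>) = ennreal P" "0 \<le> P"
    using interaction_unit_ball_finite[OF s(1,2), where 'a='a] by (simp_all add: P_def less_top)
  define T where "T = enn2real (potential (riesz s2) (- ?\<Omega>) 0)"
  have T: "potential (riesz s2) (- ?\<Omega>) 0 = ennreal T" "0 \<le> T"
    using potential_exterior_finite[OF s(3), where 'a='a] by (simp_all add: T_def less_top)
  obtain \<eta> \<delta> where \<eta>: "0 < \<eta>" and \<delta>: "0 < \<delta>"
    and dense: "\<And>\<rho>. 0 < \<rho> \<Longrightarrow> \<rho> \<le> \<delta> \<Longrightarrow>
      \<exists>q. ball q \<rho> \<subseteq> ball 0 (1 - \<delta>) \<and> ennreal (\<eta> * \<rho> ^ ?n) \<le> emeasure lebesgue (E \<inter> ball q \<rho>)"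
    using ex_ball_large_intersection[OF E] by blast
  have "1 \<le> ?n" by (simp add: Suc_leI)
  then have sn: "s1 \<le> real ?n" "s2 \<le> real ?n" using s by linarith+
  have w: "?w \<noteq> 0" using unit_ball_vol_pos[of "real ?n"] by linarith
  define \<theta> where "\<theta> = root ?n (\<eta> / ?w)"
  have \<theta>: "0 < \<theta>" "?w * \<theta> ^ ?n = \<eta>"
    using \<eta> w by (simp_all add: \<theta>_def real_root_gt_zero real_root_pow_pos2)
  define c where "c = ?w\<^sup>2 * 4 powr - (real ?n + s2)"
  have c: "0 < c" using w by (simp add: c_def)
  define M where "M = ?w * (\<delta> powr - s2 * T)"
  \<comment> \<open>\<open>a\<close> is the gain and \<open>M\<close> the lost adhesion, in units of the respective powers of \<open>\<rho>\<close>.\<close>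
  define a where "a = - \<sigma> * k2 * c * \<theta> powr (real ?n - s2)"
  have a: "0 < a" using sg k c \<theta> by (simp add: a_def mult_neg_pos)

  have main: "a * \<rho> powr (real ?n - s2) \<le> 2 * k1 * P * \<rho> powr (real ?n - s1) + - \<sigma> * k2 * M * \<rho> ^ ?n"
    if \<rho>: "0 < \<rho>" "\<rho> \<le> \<delta>" "\<rho> < \<epsilon> / 2" "\<rho> < 1" for \<rho>
  proof -
    obtain q where q: "ball q \<rho> \<subseteq> ball 0 (1 - \<delta>)" "ennreal (\<eta> * \<rho> ^ ?n) \<le> emeasure lebesgue (E \<inter> ball q \<rho>)"
      using dense[OF \<rho>(1,2)] by blast
    define D where "D = E \<inter> ball q \<rho>"
    have D: "D \<in> sets lebesgue" "D \<subseteq> E" "D \<subseteq> ball q \<rho>" using E by (auto simp: D_def)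
    have Dle: "emeasure lebesgue D \<le> ennreal (?w * \<rho> ^ ?n)"
      using emeasure_mono[OF D(3), of lebesgue] \<rho> by (simp add: emeasure_ball)
    then obtain d where d: "emeasure lebesgue D = ennreal d" "0 \<le> d" "d \<le> ?w * \<rho> ^ ?n"
    proof -
      obtain d where d: "emeasure lebesgue D = ennreal d" "0 \<le> d"
        using Dle by (metis ennreal_cases ennreal_less_top leD)
      with Dle \<rho> have "d \<le> ?w * \<rho> ^ ?n" by simp
      with d show thesis by (rule that)
    qed
    have d\<eta>: "\<eta> * \<rho> ^ ?n \<le> d" using q(2) d by (simp add: D_def)
    \<comment> \<open>The radius of \<open>A\<close> is fitted to the volume \<open>d\<close> of \<open>D\<close>, so that \<open>\<theta> * \<rho> \<le> r \<le> \<rho>\<close>.\<close>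
    define r where "r = root ?n (d / ?w)"
    have "0 < d" using d\<eta> \<eta> \<rho> by (metis mult_pos_pos order.strict_trans2 zero_less_power)
    then have r: "0 < r" "?w * r ^ ?n = d"
      using w by (simp_all add: r_def real_root_gt_zero real_root_pow_pos2)
    have r\<rho>: "r \<le> \<rho>"
    proof (rule power_le_imp_le_base[of _ "?n - 1"])
      have "?w * r ^ ?n \<le> ?w * \<rho> ^ ?n" using r d by simp
      then have "r ^ ?n \<le> \<rho> ^ ?n" by simp
      then show "r ^ Suc (?n - 1) \<le> \<rho> ^ Suc (?n - 1)" by simp
    qed (use \<rho> in simp)
    have \<theta>r: "\<theta> * \<rho> \<le> r"
    proof (rule power_le_imp_le_base[of _ "?n - 1"])
      have "?w * (\<theta> * \<rho>) ^ ?n \<le> ?w * r ^ ?n"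
        using d\<eta> r \<theta> by (simp add: power_mult_distrib mult.assoc[symmetric])
      then have "(\<theta> * \<rho>) ^ ?n \<le> r ^ ?n" using w by simp
      then show "(\<theta> * \<rho>) ^ Suc (?n - 1) \<le> r ^ Suc (?n - 1)" by simp
    qed (use r in simp)
    define A where "A = ball ((1 - r) *\<^sub>R p) r"
    have A\<Omega>: "A \<subseteq> ?\<Omega>"
    proof
      fix x assume "x \<in> A"
      then show "x \<in> ?\<Omega>"
        using norm_triangle_ineq2[of x "(1 - r) *\<^sub>R p"] p r \<rho> r\<rho> by (simp add: A_def dist_norm norm_minus_commute)
    qed
    have Ap: "A \<subseteq> ball p \<epsilon>"
    proof
      fix x assume x: "x \<in> A"
      have "p - (1 - r) *\<^sub>R p = r *\<^sub>R p" by (simp add: scaleR_diff_left)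
      then have "dist p ((1 - r) *\<^sub>R p) = r" using p r by (simp add: dist_norm)
      then show "x \<in> ball p \<epsilon>"
        using x dist_triangle[of p x "(1 - r) *\<^sub>R p"] r\<rho> \<rho> by (simp add: A_def)
    qed
    have AE: "A \<inter> E = {}" using A\<Omega> Ap \<epsilon>(2) by blast
    have A: "A \<in> sets lebesgue" "emeasure lebesgue A = emeasure lebesgue D"
      using r d by (simp_all add: A_def emeasure_ball)
    define E' where "E' = (E - D) \<union> A"
    have ED: "E - D \<in> sets lebesgue" using E D by simp
    have E': "E' \<in> sets lebesgue" "E' \<subseteq> ?\<Omega>" using ED A A\<Omega> E by (auto simp: E'_def)
    have "emeasure lebesgue E' = emeasure lebesgue (E - D) + emeasure lebesgue D"
      unfolding E'_def A(2)[symmetric] using AE ED A by (intro plus_emeasure[symmetric]) auto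
    also have "\<dots> = emeasure lebesgue ((E - D) \<union> D)"
      using ED D by (intro plus_emeasure) auto
    also have "(E - D) \<union> D = E" using D by auto
    finally have vol: "emeasure lebesgue E' = emeasure lebesgue E" .

    have I1: "?I1 E' (?\<Omega> - E') \<le> ?I1 E (?\<Omega> - E) + (ennreal (P * \<rho> powr (real ?n - s1)) + ennreal (P * \<rho> powr (real ?n - s1)))"
    proof -
      have ball: "?I1 (ball x t) (- ball x t) \<le> ennreal (P * \<rho> powr (real ?n - s1))" if "0 < t" "t \<le> \<rho>" for x t
      proof -
        have "t powr (real ?n - s1) \<le> \<rho> powr (real ?n - s1)"
          using that sn by (intro powr_mono2) auto
        then have "P * t powr (real ?n - s1) \<le> P * \<rho> powr (real ?n - s1)" using P by (intro mult_left_mono)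
        moreover have "?I1 (ball x t) (- ball x t) = ennreal (P * t powr (real ?n - s1))"
          by (simp only: interaction_ball[OF that(1)] P(1) mult.commute[of P] ennreal_mult''[OF P(2)])
        ultimately show ?thesis by (simp only: ennreal_leI)
      qed
      have "?I1 E' (?\<Omega> - E') = ?I1 (E - D) (?\<Omega> - E') + ?I1 A (?\<Omega> - E')"
        unfolding E'_def using AE ED A E' E by (intro riesz.interaction_Un_left) auto
      also have "?I1 (E - D) (?\<Omega> - E') \<le> ?I1 (E - D) ((?\<Omega> - E) \<union> D)"
        by (rule riesz.interaction_mono) (auto simp: E'_def)
      also have "\<dots> = ?I1 (E - D) (?\<Omega> - E) + ?I1 (E - D) D"
        using E D ED by (intro riesz.interaction_Un_right) auto
      also have "\<dots> \<le> ?I1 E (?\<Omega> - E) + ?I1 (- ball q \<rho>) (ball q \<rho>)"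
        by (intro add_mono riesz.interaction_mono) (auto simp: D_def)
      also have "?I1 (- ball q \<rho>) (ball q \<rho>) = ?I1 (ball q \<rho>) (- ball q \<rho>)"
        by (rule riesz.interaction_commute) auto
      also have "\<dots> \<le> ennreal (P * \<rho> powr (real ?n - s1))" using ball \<rho> by simp
      also have "?I1 A (?\<Omega> - E') \<le> ?I1 A (- A)"
        by (rule riesz.interaction_mono) (auto simp: E'_def)
      also have "\<dots> \<le> ennreal (P * \<rho> powr (real ?n - s1))" unfolding A_def using ball r r\<rho> by simp
      finally show ?thesis by (simp add: add.assoc add_mono)
    qed
    have I2D: "?I2 D (- ?\<Omega>) \<le> ennreal (M * \<rho> ^ ?n)"
    proof -
      have "?I2 D (- ?\<Omega>) \<le> (\<integral>\<^sup>+x. ennreal (\<delta> powr - s2 * T) * indicator D x \<partial>lebesgue)"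
        unfolding interaction_eq_potential
      proof (rule nn_integral_mono)
        fix x
        have "potential (riesz s2) (- ?\<Omega>) x \<le> ennreal (\<delta> powr - s2) * potential (riesz s2) (- ?\<Omega>) 0" if "x \<in> D"
        proof (rule potential_exterior_le[OF \<delta>])
          fix y :: 'a assume "y \<in> - ?\<Omega>"
          moreover have "norm x < 1 - \<delta>" using that D q by auto
          ultimately show "\<delta> \<le> dist x y"
            using norm_triangle_ineq2[of y x] by (simp add: dist_norm norm_minus_commute)
        qed
        then show "potential (riesz s2) (- ?\<Omega>) x * indicator D x \<le> ennreal (\<delta> powr - s2 * T) * indicator D x"
          using T by (auto simp: indicator_def ennreal_mult'')
      qed
      also have "\<dots> = ennreal (\<delta> powr - s2 * T) * emeasure lebesgue D"
        by (rule nn_integral_cmult_indicator[OF D(1)])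
      also have "\<dots> \<le> ennreal (\<delta> powr - s2 * T) * ennreal (?w * \<rho> ^ ?n)"
        by (intro mult_left_mono Dle) simp
      also have "\<dots> = ennreal (M * \<rho> ^ ?n)"
        using \<rho> T by (simp add: ennreal_mult''[symmetric] M_def mult_ac)
      finally show ?thesis .
    qed
    have I2A: "ennreal (c * r powr (real ?n - s2)) \<le> ?I2 A (- ?\<Omega>)"
      unfolding A_def c_def by (rule interaction_tangent_ball_ge[OF p r(1) s(3)])
    have I2E: "?I2 E (- ?\<Omega>) = ?I2 (E - D) (- ?\<Omega>) + ?I2 D (- ?\<Omega>)"
      using riesz.interaction_Un_left[of "E - D" D "- ?\<Omega>" s2] ED D by (simp add: Un_absorb2 Diff_disjoint Int_commute)
    have I2E': "?I2 E' (- ?\<Omega>) = ?I2 (E - D) (- ?\<Omega>) + ?I2 A (- ?\<Omega>)"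
      unfolding E'_def using AE ED A by (intro riesz.interaction_Un_left) auto

    have fin': "?I1 E' (?\<Omega> - E') < \<infinity>"
      by (rule order.strict_trans1[OF I1]) (use fin in \<open>simp add: ennreal_add_less_top\<close>)
    let ?C = "capillarity_energy (\<lambda>z. k1 * riesz s1 z) (\<lambda>z. k2 * riesz s2 z) \<sigma> (\<lambda>x. 0) ?\<Omega>"
    have "?C E \<le> ?C E'" using min E' vol by (auto simp: volume_constrained_minimizer_def)
    then have le: "k1 * enn2real (?I1 E (?\<Omega> - E)) + \<sigma> * k2 * enn2real (?I2 E (- ?\<Omega>))
      \<le> k1 * enn2real (?I1 E' (?\<Omega> - E')) + \<sigma> * k2 * enn2real (?I2 E' (- ?\<Omega>))"
      using k E E' fin fin' ext by (simp add: capillarity_energy_finite)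
    have fD: "?I2 (E - D) (- ?\<Omega>) < \<infinity>" "?I2 D (- ?\<Omega>) < \<infinity>" "?I2 A (- ?\<Omega>) < \<infinity>"
      by (rule ext, use E(2) D(2) A\<Omega> in fast)+
    let ?b = "P * \<rho> powr (real ?n - s1)"
    have b: "0 \<le> ?b" using P by simp
    have "enn2real (?I1 E' (?\<Omega> - E')) \<le> enn2real (?I1 E (?\<Omega> - E) + (ennreal ?b + ennreal ?b))"
      using I1 fin by (intro enn2real_mono) (simp_all add: ennreal_add_less_top)
    also have "\<dots> = enn2real (?I1 E (?\<Omega> - E)) + 2 * ?b"
      using fin b by (simp add: enn2real_plus ennreal_add_less_top)
    finally have J1: "enn2real (?I1 E' (?\<Omega> - E')) \<le> enn2real (?I1 E (?\<Omega> - E)) + 2 * ?b" .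
    have J2: "enn2real (?I2 E (- ?\<Omega>)) - enn2real (?I2 E' (- ?\<Omega>)) = enn2real (?I2 D (- ?\<Omega>)) - enn2real (?I2 A (- ?\<Omega>))"
      unfolding I2E I2E' using fD by (simp add: enn2real_plus)
    have M: "0 \<le> M * \<rho> ^ ?n" using T \<rho> by (simp add: M_def)
    have J3: "enn2real (?I2 D (- ?\<Omega>)) \<le> M * \<rho> ^ ?n"
      using enn2real_mono[OF I2D] M by simp
    have J4: "c * r powr (real ?n - s2) \<le> enn2real (?I2 A (- ?\<Omega>))"
      using enn2real_mono[OF I2A] fD(3) c by simp
    have "(\<theta> * \<rho>) powr (real ?n - s2) \<le> r powr (real ?n - s2)"
      using \<theta>r \<theta> \<rho> sn by (intro powr_mono2) auto
    then have "c * (\<theta> * \<rho>) powr (real ?n - s2) \<le> enn2real (?I2 A (- ?\<Omega>))"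
      using c by (intro order_trans[OF mult_left_mono J4]) auto
    then have "c * (\<theta> powr (real ?n - s2) * \<rho> powr (real ?n - s2)) \<le> enn2real (?I2 A (- ?\<Omega>))"
      using \<theta> \<rho> by (simp only: powr_mult less_imp_le)
    then have "- \<sigma> * k2 * (c * (\<theta> powr (real ?n - s2) * \<rho> powr (real ?n - s2))) \<le> - \<sigma> * k2 * enn2real (?I2 A (- ?\<Omega>))"
      using sg k by (intro mult_left_mono) (auto simp: mult_nonpos_nonneg)
    moreover have "- \<sigma> * k2 * enn2real (?I2 D (- ?\<Omega>)) \<le> - \<sigma> * k2 * (M * \<rho> ^ ?n)"
      using sg k J3 by (intro mult_left_mono) (auto simp: mult_nonpos_nonneg)
    moreover have "k1 * enn2real (?I1 E' (?\<Omega> - E')) \<le> k1 * (enn2real (?I1 E (?\<Omega> - E)) + 2 * ?b)"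
      using J1 k by (intro mult_left_mono) auto
    moreover have "\<sigma> * k2 * (enn2real (?I2 E (- ?\<Omega>)) - enn2real (?I2 E' (- ?\<Omega>)))
       = \<sigma> * k2 * (enn2real (?I2 D (- ?\<Omega>)) - enn2real (?I2 A (- ?\<Omega>)))" using J2 by simp
    ultimately show ?thesis
      using le unfolding a_def by (simp add: algebra_simps)
  qed

  have lim: "((\<lambda>\<rho>. 2 * k1 * P * \<rho> powr (s2 - s1) + - \<sigma> * k2 * M * \<rho> powr s2) \<longlongrightarrow>
      2 * k1 * P * 0 + - \<sigma> * k2 * M * 0) (at_right 0)"
    using \<open>\<not> s2 \<le> s1\<close> s
    by (intro tendsto_intros tendsto_zero_powrI[OF tendsto_ident_at tendsto_const])
       (auto simp: eventually_at_right_less eventually_mono[OF eventually_at_right_less] less_imp_le)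
  have "eventually (\<lambda>\<rho>. \<rho> \<in> {0<..<min \<delta> (min (\<epsilon> / 2) 1)}) (at_right 0)"
    using \<delta> \<epsilon> by (intro eventually_at_right_real) auto
  then have "eventually (\<lambda>\<rho>. a \<le> 2 * k1 * P * \<rho> powr (s2 - s1) + - \<sigma> * k2 * M * \<rho> powr s2) (at_right 0)"
  proof eventually_elim
    case (elim \<rho>)
    then have \<rho>: "0 < \<rho>" "\<rho> \<le> \<delta>" "\<rho> < \<epsilon> / 2" "\<rho> < 1" by auto
    let ?x = "\<rho> powr (real ?n - s2)"
    have x: "0 < ?x" using \<rho> by simp
    have e1: "\<rho> powr (real ?n - s1) = ?x * \<rho> powr (s2 - s1)" by (simp add: powr_add[symmetric])
    have e2: "\<rho> ^ ?n = ?x * \<rho> powr s2" using \<rho> by (simp add: powr_add[symmetric] powr_realpow[symmetric])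
    have "?x * a \<le> ?x * (2 * k1 * P * \<rho> powr (s2 - s1) + - \<sigma> * k2 * M * \<rho> powr s2)"
      using main[OF \<rho>] unfolding e1 e2 by (simp add: algebra_simps)
    then show ?case using x by (simp only: mult_le_cancel_left_pos)
  qed
  then have "a \<le> 2 * k1 * P * 0 + - \<sigma> * k2 * M * 0"
    by (intro tendsto_lowerbound[OF lim]) auto
  then show False using a by simp
qed

section \<open>The range of parameters\<close>

theorem theorem1p8:
  fixes E \<Omega> :: "(real ^ 'n) set"
    and K1 K2 g :: "real ^ 'n \<Rightarrow> real"
    and s1 s2 \<sigma> k1 k2 :: real
  assumes "CARD('n) \<ge> 2"
    and "0 < s1" "s1 < 1" "0 < s2" "s2 < 1"
    and "\<sigma> < 0"
    and "\<Omega> = ball 0 1"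
    and "g = (\<lambda>x. 0)"
    and "k1 > 0" "k2 > 0"
    and "K1 = (\<lambda>\<xi>. k1 / norm \<xi> powr (real CARD('n) + s1))"
    and "K2 = (\<lambda>\<xi>. k2 / norm \<xi> powr (real CARD('n) + s2))"
    and "volume_constrained_minimizer K1 K2 \<sigma> g \<Omega> E"
    and "\<exists>p\<in>sphere 0 1. \<exists>\<epsilon>0>0. ball p \<epsilon>0 \<inter> ball 0 1 \<subseteq> \<Omega> - E"
    and "Reg s1 \<Omega> E \<inter> \<Omega> \<noteq> {}"
  shows "s1 > s2 \<or> (s1 = s2 \<and> - k1 < \<sigma> * k2)"
proof (rule ccontr)
  assume neg: "\<not> (s1 > s2 \<or> (s1 = s2 \<and> - k1 < \<sigma> * k2))"
  have K: "K1 = (\<lambda>z. k1 * riesz s1 z)" "K2 = (\<lambda>z. k2 * riesz s2 z)"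
    using assms by (simp_all add: riesz_def)
  have min: "volume_constrained_minimizer (\<lambda>z. k1 * riesz s1 z) (\<lambda>z. k2 * riesz s2 z) \<sigma> (\<lambda>x. 0) (ball 0 1) E"
    using assms(13) unfolding K assms(7,8) .
  obtain p \<epsilon> where p: "norm p = 1" and \<epsilon>: "0 < \<epsilon>" "ball p \<epsilon> \<inter> ball 0 1 \<subseteq> ball 0 1 - E"
    using assms(14) unfolding assms(7) by auto
  have "s2 \<le> s1"
    by (rule order_le_if_minimizer_vacant[OF assms(2-5) assms(9,10,6) min p \<epsilon>])
  with neg have s: "s2 = s1" and k: "k1 \<le> - \<sigma> * k2" by auto
  have E: "E \<subseteq> ball 0 1" "E \<in> sets lebesgue" "0 < emeasure lebesgue E"
    using min by (auto simp: volume_constrained_minimizer_def)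
  have "negligible E"
  proof (rule negligible_if_vacant_ball[OF E(1) _ _ p \<epsilon>(1)])
    show "2 \<le> DIM(real ^ 'n)" using assms(1) by simp
    have "E \<inter> ball p \<epsilon> = {}" using \<epsilon>(2) E(1) by blast
    then show "negligible (E \<inter> ball p \<epsilon>)" by simp
  qed (rule minimizer_polarization_dichotomy[OF _ assms(2,3) _ assms(9,10) k min[unfolded s]])
  then show False using E by (simp add: negligible_iff_emeasure0)
qed

end
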